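(* Suppose $\mu\neq0$ and $\sigma^2_{\mu_\perp}>0$. Then, as $n\to\infty$, \[ \psi_n^\mu(\operatorname{hull}\{S_0,S_1,\ldots,S_n\}) \Rightarrow \tilde h_1 \] in the sense of weak convergence on $(\mathcal{K}_2^0,\rho_H)$.
   Context: $Z$ is a random vector in $\mathbb{R}^2$ with $\mathbb{E}[\|Z\|^2]<\infty$; $Z_1,Z_2,\ldots$ are i.i.d. copies of $Z$; $S_0=0$, $S_n=\sum_{k=1}^n Z_k$. $\mu=\mathbb{E}Z$, $\sigma^2=\mathbb{E}[\|Z-\mu\|^2]$; for $\mu\neq0$, $\hat\mu=\mu/\|\mu\|$, $\sigma^2_\mu=\mathbb{E}[((Z-\mu)\cdot\hat\mu)^2]$, $\sigma^2_{\mu_\perp}=\sigma^2-\sigma^2_\mu$, and $\hat\mu_\perp$ is the unit vector obtained by rotating $\hat\mu$ by $\pi/2$ anticlockwise. $\psi_n^\mu:\mathbb{R}^2\to\mathbb{R}^2$ is $\psi_n^\mu(x)=\big(\frac{x\cdot\hat\mu}{n\|\mu\|},\frac{x\cdot\hat\mu_\perp}{\sqrt{n\sigma^2_{\mu_\perp}}}\big)$ in Cartesian coordinates. $w$ is standard one-dimensional Brownian motion with $w(0)=0$, $\tilde b(s)=(s,w(s))$ for $s\in[0,1]$, and $\tilde h_1=\operatorname{hull}\tilde b[0,1]$. $\mathcal{K}_2^0$ is the collection of compact convex subsets of $\mathbb{R}^2$ containing the origin, with Hausdorff metric $\rho_H(A,B)=\max\{\sup_{x\in B}\rho(x,A),\sup_{y\in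 A}\rho(y,B)\}$, $\rho(x,A)=\inf_{y\in A}\|x-y\|$. *)

theory Defs
  imports "HOL-Analysis.Analysis" "HOL-Probability.Probability"
begin

definition haus_dist :: "(real \<times> real) set \<Rightarrow> (real \<times> real) set \<Rightarrow> real" where
  "haus_dist A B = max (SUP x\<in>B. infdist x A) (SUP y\<in>A. infdist y B)"

definition K20 :: "(real \<times> real) set set" where
  "K20 = {K. compact K \<and> convex K \<and> (0::real \<times> real) \<in> K}"

definition bcont_K20 :: "((real \<times> real) set \<Rightarrow> real) \<Rightarrow> bool" where
  "bcont_K20 f \<longleftrightarrow>
     (\<exists>C. \<forall>A\<in>K20. \<bar>f A\<bar> \<le> C) \<and>
     (\<forall>A\<in>K20. \<forall>e>0. \<exists>d>0. \<forall>B\<in>K20. haus_dist A B < d \<longrightarrow> \<bar>f B - f A\<bar> < e)"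

definition weak_conv_K20 ::
  "'a measure \<Rightarrow> (nat \<Rightarrow> 'a \<Rightarrow> (real \<times> real) set) \<Rightarrow> 'b measure \<Rightarrow> ('b \<Rightarrow> (real \<times> real) set) \<Rightarrow> bool" where
  "weak_conv_K20 M X N Y \<longleftrightarrow>
     (\<forall>f. bcont_K20 f \<longrightarrow>
        (\<lambda>n. integral\<^sup>L M (\<lambda>\<omega>. f (X n \<omega>))) \<longlonglongrightarrow> integral\<^sup>L N (\<lambda>\<omega>. f (Y \<omega>)))"

definition brownian_motion :: "'b measure \<Rightarrow> ('b \<Rightarrow> real \<Rightarrow> real) \<Rightarrow> bool" where
  "brownian_motion N w \<longleftrightarrow>
     prob_space N \<and>
     (\<forall>\<omega>\<in>space N. w \<omega> 0 = 0 \<and> continuous_on {0..} (w \<omega>)) \<and>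
     (\<forall>t. 0 \<le> t \<longrightarrow> (\<lambda>\<omega>. w \<omega> t) \<in> borel_measurable N) \<and>
     (\<forall>s t. 0 \<le> s \<and> s < t \<longrightarrow>
        distributed N lborel (\<lambda>\<omega>. w \<omega> t - w \<omega> s) (normal_density 0 (sqrt (t - s)))) \<and>
     (\<forall>(n::nat) (ts::nat \<Rightarrow> real). 0 \<le> ts 0 \<and> (\<forall>i<n. ts i < ts (Suc i)) \<longrightarrow>
        prob_space.indep_vars N (\<lambda>_. borel) (\<lambda>i \<omega>. w \<omega> (ts (Suc i)) - w \<omega> (ts i)) {..<n})"

definition rot90 :: "real \<times> real \<Rightarrow> real \<times> real" where
  "rot90 v = (- snd v, fst v)"

end

theory Submission
  imports Defs
begin

text \<open>After the linear change of coordinates the hull is that of the points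
  \<open>(T\<^sub>i / n, W\<^sub>i / \<surd>n)\<close>, where \<open>T\<close> is a walk of mean 1 and \<open>W\<close> a centred walk of unit variance.
  Cut the time interval into \<open>m\<close> blocks and keep only the block end points, with first coordinates
  \<open>j / m\<close>. By Ottaviani's inequality and the central limit theorem this changes the hull
  by little in the Hausdorff distance, with high probability, when \<open>m\<close> is large and \<open>n \<longlonglongrightarrow> \<infinity>\<close>. For fixed \<open>m\<close>
  the hull is a continuous function of \<open>m\<close> independent block increments, which converge in law to
  the increments of Brownian motion; uniform continuity of the Brownian path lets \<open>m \<longlonglongrightarrow> \<infinity>\<close>. It
  suffices to test against Lipschitz functions, because a bounded continuous function is an
  increasing limit of Lipschitz ones.\<close>

section \<open>Hausdorff distance of convex hulls\<close>

text \<open>Only second moments are available, and this shapes the block argument. The second-moment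
  bound for the maximum over one block is of order 1 / (e^2 m), so its union over m blocks does not
  become small. The central limit theorem replaces it by a Gaussian fourth-moment bound of order 1 /
  (e^4 m^2), at the price of holding only for n large depending on m; hence m is fixed before n
  tends to infinity. The coordinates \<open>T\<close> and \<open>W\<close> may be dependent, yet no
  joint limit law is needed: \<open>T\<close> follows deterministic time up to o(n), uniformly and
  in probability, so its deviations are absorbed into the exceptional event. The space
  \<open>K20\<close> carries no sigma-algebra here. The measurability of \<open>f\<close> applied to
  a random hull is therefore proved for each \<open>f\<close> with \<open>bcont_K20 f\<close>,
  starting from hulls of finitely many points.\<close>

lemma haus_dist_le_iff:
  assumes "compact A" "A \<noteq> {}" "compact B" "B \<noteq> {}"
  shows "haus_dist A B \<le> e \<longleftrightarrow> (\<forall>x\<in>B. infdist x A \<le> e) \<and> (\<forall>y\<in>A. infdist y B \<le> e)"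
proof -
  have bdd: "bdd_above ((\<lambda>x. infdist x C) ` D)" if "compact D" for C D :: "(real \<times> real) set"
    by (intro bounded_imp_bdd_above compact_imp_bounded compact_continuous_image that
        continuous_intros)
  show ?thesis
    unfolding haus_dist_def using assms by (simp add: cSUP_le_iff bdd)
qed

lemma haus_dist_commute: "haus_dist A B = haus_dist B A"
  by (simp add: haus_dist_def max.commute)

lemma haus_dist_self: "A \<noteq> {} \<Longrightarrow> haus_dist A A = 0"
  by (simp add: haus_dist_def)

lemma haus_dist_nonneg:
  assumes "compact A" "A \<noteq> {}" "compact B" "B \<noteq> {}"
  shows "0 \<le> haus_dist A B"
proof -
  obtain x where "x \<in> B" using assms by auto
  then have "infdist x A \<le> haus_dist A B"
    using haus_dist_le_iff[OF assms, of "haus_dist A B"] by auto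
  then show ?thesis using infdist_nonneg[of x A] by linarith
qed

lemma infdist_le_infdist_haus_dist:
  assumes "compact A" "A \<noteq> {}" "compact B" "B \<noteq> {}"
  shows "infdist x B \<le> infdist x A + haus_dist A B"
proof -
  obtain a where a: "a \<in> A" "infdist x A = dist x a"
    using infdist_attains_inf[of A x] compact_imp_closed assms by auto
  have "infdist x B \<le> infdist a B + dist x a" by (rule infdist_triangle)
  moreover have "infdist a B \<le> haus_dist A B"
    using haus_dist_le_iff[OF assms, of "haus_dist A B"] a by auto
  ultimately show ?thesis using a by simp
qed

lemma haus_dist_triangle:
  assumes A: "compact A" "A \<noteq> {}" and B: "compact B" "B \<noteq> {}" and C: "compact C" "C \<noteq> {}"
  shows "haus_dist A C \<le> haus_dist A B + haus_dist B C"
  unfolding haus_dist_le_iff[OF A C]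
proof safe
  have AB: "\<forall>x\<in>A. infdist x B \<le> haus_dist A B"
    using haus_dist_le_iff[OF A B, of "haus_dist A B"] by auto
  have BC: "\<forall>x\<in>C. infdist x B \<le> haus_dist B C"
    using haus_dist_le_iff[OF B C, of "haus_dist B C"] by auto
  fix a b
  show "infdist (a, b) A \<le> haus_dist A B + haus_dist B C" if "(a, b) \<in> C"
    using infdist_le_infdist_haus_dist[OF B A, of "(a, b)"] bspec[OF BC that]
    by (simp add: haus_dist_commute)
  show "infdist (a, b) C \<le> haus_dist A B + haus_dist B C" if "(a, b) \<in> A"
    using infdist_le_infdist_haus_dist[OF B C, of "(a, b)"] bspec[OF AB that] by simp
qed

text \<open>The Minkowski sum of \<open>convex hull Q\<close> and the closed ball of radius
  \<open>e\<close> is convex and contains \<open>P\<close>, hence contains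
  \<open>convex hull P\<close>.\<close>

lemma infdist_convex_hull_le:
  fixes P Q :: "'a::real_normed_vector set"
  assumes "\<And>p. p \<in> P \<Longrightarrow> \<exists>q\<in>Q. dist p q \<le> e" and x: "x \<in> convex hull P"
  shows "infdist x (convex hull Q) \<le> e"
proof -
  let ?C = "\<Union>x\<in>convex hull Q. \<Union>y\<in>cball 0 e. {x + y}"
  have "P \<subseteq> ?C"
  proof
    fix p assume "p \<in> P"
    then obtain q where "q \<in> Q" "dist p q \<le> e" using assms(1) by blast
    then have "q \<in> convex hull Q" "p - q \<in> cball 0 e" "p = q + (p - q)"
      by (auto intro: hull_inc simp: dist_norm norm_minus_commute)
    then show "p \<in> ?C" by blast
  qed
  then have "convex hull P \<subseteq> ?C"
    by (intro hull_minimal convex_sums) auto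
  with x obtain y z where "y \<in> convex hull Q" "norm z \<le> e" "x = y + z" by auto
  then show ?thesis
    by (intro infdist_le2[of y]) (auto simp: dist_norm)
qed

lemma haus_dist_convex_hull_le:
  assumes "compact P" "P \<noteq> {}" "compact Q" "Q \<noteq> {}"
    and "\<And>p. p \<in> P \<Longrightarrow> \<exists>q\<in>Q. dist p q \<le> e" "\<And>q. q \<in> Q \<Longrightarrow> \<exists>p\<in>P. dist q p \<le> e"
  shows "haus_dist (convex hull P) (convex hull Q) \<le> e"
  using assms
  by (subst haus_dist_le_iff)
    (auto intro!: compact_convex_hull infdist_convex_hull_le[OF assms(5)]
      infdist_convex_hull_le[OF assms(6)])

lemma K20_compact: "A \<in> K20 \<Longrightarrow> compact A" and K20_nonempty: "A \<in> K20 \<Longrightarrow> A \<noteq> {}"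
  by (auto simp: K20_def)

lemma convex_hull_in_K20: "compact P \<Longrightarrow> 0 \<in> P \<Longrightarrow> convex hull P \<in> K20"
  by (auto simp: K20_def intro!: compact_convex_hull hull_inc)

text \<open>Since \<^term>\<open>bcont_K20\<close> is only pointwise continuity, the test functions are replaced by
  their inf-convolutions with multiples of the metric, which are Lipschitz and increase to them.\<close>

definition lip_K20 :: "((real \<times> real) set \<Rightarrow> real) \<Rightarrow> real \<Rightarrow> real \<Rightarrow> bool" where
  "lip_K20 f C L \<longleftrightarrow> L \<ge> 0 \<and> (\<forall>A\<in>K20. \<bar>f A\<bar> \<le> C) \<and>
     (\<forall>A\<in>K20. \<forall>B\<in>K20. \<bar>f A - f B\<bar> \<le> L * haus_dist A B)"

lemma lip_K20_imp_bcont_K20: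
  assumes "lip_K20 f C L"
  shows "bcont_K20 f"
  unfolding bcont_K20_def
proof (intro conjI ballI allI impI)
  show "\<exists>C. \<forall>A\<in>K20. \<bar>f A\<bar> \<le> C" using assms by (auto simp: lip_K20_def)
  fix A e assume A: "A \<in> K20" and e: "(e::real) > 0"
  show "\<exists>d>0. \<forall>B\<in>K20. haus_dist A B < d \<longrightarrow> \<bar>f B - f A\<bar> < e"
  proof (intro exI[of _ "e / (L + 1)"] conjI ballI impI)
    have L: "L \<ge> 0" using assms by (auto simp: lip_K20_def)
    then show "e / (L + 1) > 0" using e by simp
    fix B assume B: "B \<in> K20" and d: "haus_dist A B < e / (L + 1)"
    have "\<bar>f B - f A\<bar> \<le> L * haus_dist A B"
      using assms A B by (metis lip_K20_def haus_dist_commute)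
    also have "\<dots> \<le> (L + 1) * haus_dist A B"
      using haus_dist_nonneg[of A B] A B
      by (intro mult_right_mono) (auto simp: K20_compact K20_nonempty)
    also have "\<dots> < e" using d L by (simp add: field_simps)
    finally show "\<bar>f B - f A\<bar> < e" .
  qed
qed

lemma lipschitz_minorants:
  assumes f: "bcont_K20 f"
  obtains g C where "\<And>k::nat. lip_K20 (g k) C (real k)"
    "\<And>k A. A \<in> K20 \<Longrightarrow> g k A \<le> f A" "\<And>A. A \<in> K20 \<Longrightarrow> (\<lambda>k. g k A) \<longlonglongrightarrow> f A"
proof -
  obtain C where C: "\<And>A. A \<in> K20 \<Longrightarrow> \<bar>f A\<bar> \<le> C"
    using f unfolding bcont_K20_def by blast
  note [simp] = K20_compact K20_nonempty
  define g where "g k A = (INF B\<in>K20. f B + real k * haus_dist A B)" for k :: nat and A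
  have "{0} \<in> K20" unfolding K20_def by simp
  then have ne: "K20 \<noteq> {}" by blast
  have lb: "- C \<le> f B + real k * haus_dist A B" if "A \<in> K20" "B \<in> K20" for k A B
  proof -
    have "0 \<le> real k * haus_dist A B" using that haus_dist_nonneg[of A B] by simp
    then show ?thesis using C[OF that(2)] by linarith
  qed
  have bdd: "bdd_below ((\<lambda>B. f B + real k * haus_dist A B) ` K20)" if "A \<in> K20" for k A
    using lb[OF that] by (intro bdd_belowI[of _ "- C"]) auto
  have gle: "g k A \<le> f B + real k * haus_dist A B" if "A \<in> K20" "B \<in> K20" for k A B
    unfolding g_def by (rule cINF_lower[OF bdd[OF that(1)] that(2)])
  have gf: "g k A \<le> f A" if "A \<in> K20" for k A
    using gle[OF that that, of k] that by (simp add: haus_dist_self)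
  have gge: "c \<le> g k A" if "\<And>B. B \<in> K20 \<Longrightarrow> c \<le> f B + real k * haus_dist A B" for k A c
    unfolding g_def by (rule cINF_greatest[OF ne that])
  have glip: "g k A - g k B \<le> real k * haus_dist A B" if "A \<in> K20" "B \<in> K20" for k A B
  proof -
    have "g k A - real k * haus_dist A B \<le> g k B"
    proof (rule gge)
      fix D assume D: "D \<in> K20"
      have "g k A \<le> f D + real k * haus_dist A D" using gle[OF that(1) D] .
      also have "\<dots> \<le> f D + real k * (haus_dist A B + haus_dist B D)"
        using that D by (intro add_left_mono mult_left_mono haus_dist_triangle) auto
      finally show "g k A - real k * haus_dist A B \<le> f D + real k * haus_dist B D"
        by (simp add: algebra_simps)
    qed
    then show ?thesis by simp
  qed
  have "lip_K20 (g k) C (real k)" for k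
    unfolding lip_K20_def
  proof (intro conjI ballI)
    fix A assume A: "A \<in> K20"
    have "- C \<le> g k A" by (rule gge[OF lb[OF A]])
    then show "\<bar>g k A\<bar> \<le> C" using gf[OF A, of k] C[OF A] by auto
    fix B assume B: "B \<in> K20"
    show "\<bar>g k A - g k B\<bar> \<le> real k * haus_dist A B"
      using glip[OF A B, of k] glip[OF B A, of k] by (simp add: haus_dist_commute abs_le_iff)
  qed simp
  moreover have "(\<lambda>k. g k A) \<longlonglongrightarrow> f A" if A: "A \<in> K20" for A
  proof (rule LIMSEQ_I)
    fix e :: real assume e: "e > 0"
    then obtain d where d: "d > 0" "\<And>B. B \<in> K20 \<Longrightarrow> haus_dist A B < d \<Longrightarrow> \<bar>f B - f A\<bar> < e / 2"
      using f A unfolding bcont_K20_def by (meson half_gt_zero)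
    \<comment> \<open>A set \<open>B\<close> at distance at least \<open>d\<close> from
      \<open>A\<close> pays a penalty above \<open>2 * C\<close>, which bounds any possible drop of
      \<open>f\<close>. Only sets near \<open>A\<close>, where \<open>f\<close> is within
      \<open>e / 2\<close> of \<open>f A\<close>, can bring the infimum down.\<close>
    obtain k0 :: nat where k0: "real k0 > 2 * C / d" using reals_Archimedean2 by blast
    show "\<exists>k0. \<forall>k\<ge>k0. norm (g k A - f A) < e"
    proof (intro exI[of _ k0] allI impI)
      fix k assume k: "k0 \<le> k"
      have "f A - e / 2 \<le> g k A"
      proof (rule gge)
        fix B assume B: "B \<in> K20"
        show "f A - e / 2 \<le> f B + real k * haus_dist A B"
        proof (cases "haus_dist A B < d")
          case True
          have "\<bar>f B - f A\<bar> < e / 2" by (rule d(2)[OF B True])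
          moreover have "0 \<le> real k * haus_dist A B" using A B haus_dist_nonneg[of A B] by simp
          ultimately show ?thesis by linarith
        next
          case False
          have "2 * C < real k0 * d" using k0 d by (simp add: field_simps)
          also have "\<dots> \<le> real k * haus_dist A B"
            using k False d by (intro mult_mono) auto
          finally show ?thesis using C[OF A] C[OF B] e by linarith
        qed
      qed
      then show "norm (g k A - f A) < e" using gf[OF A, of k] e by auto
    qed
  qed
  ultimately show ?thesis using that gf by blast
qed

section \<open>Continuity and measurability of hulls of finitely many points\<close>

lemma continuous_on_K20_hull:
  fixes p :: "nat \<Rightarrow> 'x::topological_space \<Rightarrow> real \<times> real"
  assumes f: "bcont_K20 f" and p: "\<And>j. continuous_on UNIV (p j)" and p0: "\<And>x. p 0 x = 0"
  shows "continuous_on UNIV (\<lambda>x. f (convex hull ((\<lambda>j. p j x) ` {0..m})))"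
  unfolding continuous_on_def
proof (intro ballI tendstoI)
  fix x and e :: real assume e: "e > 0"
  let ?K = "\<lambda>x. convex hull ((\<lambda>j. p j x) ` {0..m})"
  have K: "?K x \<in> K20" for x
    using p0[of x] by (intro convex_hull_in_K20) (auto intro: finite_imp_compact image_eqI[of _ _ 0])
  obtain d where d: "d > 0" "\<And>B. B \<in> K20 \<Longrightarrow> haus_dist (?K x) B < d \<Longrightarrow> \<bar>f B - f (?K x)\<bar> < e"
    using f K e unfolding bcont_K20_def by meson
  have "\<forall>\<^sub>F y in at x within UNIV. \<forall>j\<in>{0..m}. dist (p j y) (p j x) < d / 2"
  proof (intro eventually_ball_finite ballI)
    fix j
    have "(p j \<longlongrightarrow> p j x) (at x)" using p[of j] by (auto simp: continuous_on_def)
    then show "\<forall>\<^sub>F y in at x. dist (p j y) (p j x) < d / 2"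
      using d(1) by (intro tendstoD) auto
  qed simp
  then show "\<forall>\<^sub>F y in at x within UNIV. dist (f (?K y)) (f (?K x)) < e"
  proof eventually_elim
    case (elim y)
    have "haus_dist (?K x) (?K y) \<le> d / 2"
    proof (rule haus_dist_convex_hull_le)
      show "\<exists>r\<in>(\<lambda>j. p j y) ` {0..m}. dist q r \<le> d / 2" if "q \<in> (\<lambda>j. p j x) ` {0..m}" for q
        using that elim by (auto simp: dist_commute intro!: less_imp_le)
      show "\<exists>r\<in>(\<lambda>j. p j x) ` {0..m}. dist q r \<le> d / 2" if "q \<in> (\<lambda>j. p j y) ` {0..m}" for q
        using that elim by (auto intro!: less_imp_le)
    qed (auto intro!: finite_imp_compact)
    then show ?case using d(1) d(2)[OF K, of y] by (simp add: dist_real_def)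
  qed
qed

text \<open>The functional is a continuous function of the whole sequence of points, and the
  sequence depends measurably on the sample; composing the two avoids any sigma-algebra on
  sets.\<close>

lemma borel_measurable_K20_hull:
  fixes p :: "nat \<Rightarrow> 'a \<Rightarrow> real \<times> real"
  assumes f: "bcont_K20 f" and p: "\<And>j. p j \<in> borel_measurable M" and p0: "\<And>x. p 0 x = 0"
  shows "(\<lambda>x. f (convex hull ((\<lambda>j. p j x) ` {0..m}))) \<in> borel_measurable M"
proof -
  \<comment> \<open>Subtracting \<open>x 0\<close> puts the origin among the points for every
    sequence \<open>x\<close>, so that the hull stays in \<open>K20\<close>; for the given
    \<open>p\<close> nothing changes, since \<open>p 0\<close> vanishes.\<close>
  have "continuous_on UNIV (\<lambda>x::nat \<Rightarrow> real \<times> real. f (convex hull ((\<lambda>j. x j - x 0) ` {0..m})))"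
    by (intro continuous_on_K20_hull f continuous_intros continuous_on_product_coordinates) simp
  then have "(\<lambda>x::nat \<Rightarrow> real \<times> real. f (convex hull ((\<lambda>j. x j - x 0) ` {0..m}))) \<in> borel_measurable borel"
    by (rule borel_measurable_continuous_onI)
  moreover have "(\<lambda>x j. p j x) \<in> borel_measurable M"
    by (rule measurable_coordinatewise_then_product) (rule p)
  ultimately have "(\<lambda>x. f (convex hull ((\<lambda>j. p j x - p 0 x) ` {0..m}))) \<in> borel_measurable M"
    by (rule measurable_compose[rotated])
  then show ?thesis by (simp add: p0)
qed

section \<open>Hulls of walks sampled at block end points\<close>

definition skeleton :: "nat \<Rightarrow> (nat \<Rightarrow> real) \<Rightarrow> (real \<times> real) set" where
  "skeleton m x = convex hull ((\<lambda>j. (real j / real m, \<Sum>i<j. x i)) ` {0..m})"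

lemma skeleton_in_K20: "skeleton m x \<in> K20"
  unfolding skeleton_def
  by (intro convex_hull_in_K20) (auto intro!: finite_imp_compact image_eqI[of _ _ 0] simp: zero_prod_def)

text \<open>Only the first \<open>m\<close> increments enter. This matches the restricted families
  over \<open>{..<m}\<close> that finite product measures produce.\<close>

lemma skeleton_restrict: "skeleton m (restrict x {..<m}) = skeleton m x"
proof -
  have "(\<Sum>i<j. restrict x {..<m} i) = (\<Sum>i<j. x i)" if "j \<le> m" for j
    using that by (intro sum.cong) auto
  then show ?thesis unfolding skeleton_def by (intro arg_cong[where f="\<lambda>A. convex hull A"] image_cong) auto
qed

lemma continuous_on_skeleton:
  assumes "bcont_K20 f"
  shows "continuous_on UNIV (\<lambda>x. f (skeleton m x))"
  unfolding skeleton_def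
  by (intro continuous_on_K20_hull assms continuous_intros continuous_on_product_coordinates)
    (simp add: zero_prod_def)

lemma dist_Pair_le: "dist (a, b) (c, d) \<le> \<bar>a - c\<bar> + \<bar>b - d\<bar>" for a b c d :: real
  by (simp add: dist_Pair_Pair dist_real_def sqrt_sum_squares_le_sum_abs[of "a - c" "b - d", simplified])

text \<open>A deterministic comparison: index \<open>i = j * q + r\<close> is matched with vertex
  \<open>j\<close>. The three errors of size \<open>e\<close> come from \<open>t i\<close> against
  \<open>i\<close>, from \<open>i / n\<close> against \<open>j / m\<close>, and from the second
  coordinate within a block. The value \<open>j = m\<close> is allowed in the hypothesis on
  \<open>y\<close> because up to \<open>m - 1\<close> indices remain after the last full
  block.\<close>

lemma haus_dist_walk_skeleton_le:
  fixes t y :: "nat \<Rightarrow> real"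
  assumes m: "m > 0" "1 / real m \<le> e" and n: "n > 0" "real m / real n \<le> e" and q: "q = n div m" "m \<le> q"
    and t: "\<And>i. i \<le> n \<Longrightarrow> \<bar>t i - real i\<bar> \<le> e * real n"
    and y: "\<And>j r. j \<le> m \<Longrightarrow> r \<le> q \<Longrightarrow> \<bar>\<Sum>k\<in>{j * q..<j * q + r}. y k\<bar> \<le> e * sqrt n"
  shows "haus_dist (convex hull ((\<lambda>i. (t i / n, (\<Sum>k<i. y k) / sqrt n)) ` {0..n}))
      (skeleton m (\<lambda>i. (\<Sum>k\<in>{i * q..<i * q + q}. y k) / sqrt n)) \<le> 3 * e"
proof -
  have mq: "m * q \<le> n" "n < m * q + m"
    using mod_less_divisor[OF m(1), of n] mult_div_mod_eq[of m n] unfolding q(1) by linarith+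
  have mq': "real m * real q \<le> real n" "real n \<le> real m * real q + real m"
    using mq unfolding of_nat_mult[symmetric] of_nat_add[symmetric] of_nat_le_iff by auto
  have blocks: "(\<Sum>i<j. (\<Sum>k\<in>{i * q..<i * q + q}. y k) / sqrt n) = (\<Sum>k<j * q. y k) / sqrt n" for j
    unfolding sum_divide_distrib[symmetric] sum.nat_group by (simp add: sum.nat_group)
  have key: "dist (t i / n, (\<Sum>k<i. y k) / sqrt n)
      (real j / real m, (\<Sum>i<j. (\<Sum>k\<in>{i * q..<i * q + q}. y k) / sqrt n)) \<le> 3 * e"
    if i: "i \<le> n" "i = j * q + r" and j: "j \<le> m" and r: "r \<le> q" for i j r
  proof -
    have "(\<Sum>k<i. y k) = (\<Sum>k<j * q. y k) + (\<Sum>k\<in>{j * q..<j * q + r}. y k)"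
      unfolding i(2) by (simp add: lessThan_atLeast0 sum.atLeastLessThan_concat)
    then have "\<bar>(\<Sum>k<i. y k) / sqrt n - (\<Sum>k<j * q. y k) / sqrt n\<bar> = \<bar>\<Sum>k\<in>{j * q..<j * q + r}. y k\<bar> / sqrt n"
      by (simp add: add_divide_distrib)
    also have "\<dots> \<le> e" using y[OF j r] n by (simp add: divide_le_eq)
    finally have 1: "\<bar>(\<Sum>k<i. y k) / sqrt n - (\<Sum>k<j * q. y k) / sqrt n\<bar> \<le> e" .
    have 2: "\<bar>t i / n - i / n\<bar> \<le> e"
      using t[OF i(1)] n by (simp add: diff_divide_distrib[symmetric] divide_le_eq)
    have rn: "real r / n \<le> e"
    proof -
      have "real r * m \<le> n"
        using r mq'(1) mult_right_mono[of "real r" "real q" "real m"] by (simp add: mult.commute)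
      then have "real r / n \<le> 1 / m" using n m by (simp add: field_simps)
      then show ?thesis using m(2) by linarith
    qed
    have lo: "real j / m - real j * real q / n \<le> e"
    proof -
      have "real j / m - real j * real q / n = (real j / m) * ((real n - m * real q) / n)"
        using m n by (simp add: field_simps)
      also have "\<dots> \<le> 1 * (m / n)"
        using m n j mq' by (intro mult_mono divide_right_mono) auto
      finally show ?thesis using n(2) by simp
    qed
    have hi: "real j * real q / n \<le> real j / m"
      using m n mult_left_mono[OF mq'(1), of "real j"] by (simp add: field_simps)
    \<comment> \<open>The difference of \<open>i / n\<close> and \<open>j / m\<close> is
      \<open>r / n\<close> minus \<open>j / m - j * q / n\<close>. Both terms lie between 0 and
      \<open>e\<close>, so the difference is bounded by \<open>e\<close> and not merely by
      \<open>2 * e\<close>.\<close>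
    have "real i / n = real j * real q / n + real r / n"
      unfolding i(2) by (simp add: add_divide_distrib)
    then have 3: "\<bar>real i / n - real j / m\<bar> \<le> e"
      using rn lo hi by (smt (verit) divide_nonneg_nonneg of_nat_0_le_iff)
    show ?thesis
      unfolding blocks by (rule order_trans[OF dist_Pair_le]) (use 1 2 3 in linarith)
  qed
  have q0: "q > 0" using m q by simp
  show ?thesis
    unfolding skeleton_def
  proof (rule haus_dist_convex_hull_le)
    fix p assume "p \<in> (\<lambda>i. (t i / n, (\<Sum>k<i. y k) / sqrt n)) ` {0..n}"
    then obtain i where i: "i \<le> n" "p = (t i / n, (\<Sum>k<i. y k) / sqrt n)" by auto
    \<comment> \<open>Here \<open>m \<le> q\<close> enters: the fewer than \<open>m\<close> indices
      left after \<open>m * q\<close> fit into one further block.\<close>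
    have "i < Suc m * q" using i(1) mq(2) q(2) by simp
    then have "i div q \<le> m" using q0 by (metis less_Suc_eq_le less_mult_imp_div_less)
    moreover have "i mod q \<le> q" using q0 by (simp add: less_imp_le)
    ultimately show "\<exists>p'\<in>(\<lambda>j. (real j / real m, \<Sum>i<j. (\<Sum>k\<in>{i * q..<i * q + q}. y k) / sqrt n)) ` {0..m}. dist p p' \<le> 3 * e"
      using key[of i "i div q" "i mod q"] i by auto
  next
    fix p assume "p \<in> (\<lambda>j. (real j / real m, \<Sum>i<j. (\<Sum>k\<in>{i * q..<i * q + q}. y k) / sqrt n)) ` {0..m}"
    then obtain j where j: "j \<le> m" "p = (real j / real m, \<Sum>i<j. (\<Sum>k\<in>{i * q..<i * q + q}. y k) / sqrt n)" by auto
    have "j * q \<le> n" using mult_le_mono1[OF j(1), of q] mq(1) by linarith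
    then show "\<exists>p'\<in>(\<lambda>i. (t i / n, (\<Sum>k<i. y k) / sqrt n)) ` {0..n}. dist p p' \<le> 3 * e"
      using key[of "j * q" j 0] j by (auto simp: dist_commute)
  qed (auto intro!: finite_imp_compact)
qed

section \<open>Expectations of test functions and weak convergence\<close>

lemma abs_expectation_diff_le:
  fixes F F' :: "'a \<Rightarrow> real"
  assumes "prob_space M" and [measurable]: "F \<in> borel_measurable M" "F' \<in> borel_measurable M" "B \<in> sets M"
    and C: "\<And>\<omega>. \<bar>F \<omega>\<bar> \<le> C" "\<And>\<omega>. \<bar>F' \<omega>\<bar> \<le> C"
    and a: "0 \<le> a" "\<And>\<omega>. \<omega> \<in> space M \<Longrightarrow> \<omega> \<notin> B \<Longrightarrow> \<bar>F \<omega> - F' \<omega>\<bar> \<le> a"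
  shows "\<bar>integral\<^sup>L M F - integral\<^sup>L M F'\<bar> \<le> a + 2 * C * measure M B"
proof -
  interpret prob_space M by fact
  have int: "integrable M F" "integrable M F'"
    by (auto intro!: integrable_const_bound[of _ C] simp: C)
  have intB: "integrable M (\<lambda>\<omega>. a + 2 * C * indicator B \<omega>)"
    by (auto simp: emeasure_eq_measure)
  have "\<bar>expectation F - expectation F'\<bar> = \<bar>expectation (\<lambda>\<omega>. F \<omega> - F' \<omega>)\<bar>" using int by simp
  also have "\<dots> \<le> expectation (\<lambda>\<omega>. \<bar>F \<omega> - F' \<omega>\<bar>)" by (rule integral_abs_bound)
  also have "\<dots> \<le> expectation (\<lambda>\<omega>. a + 2 * C * indicator B \<omega>)"
  proof (rule integral_mono[OF _ intB])
    show "integrable M (\<lambda>\<omega>. \<bar>F \<omega> - F' \<omega>\<bar>)" using int by simp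
    show "\<bar>F \<omega> - F' \<omega>\<bar> \<le> a + 2 * C * indicator B \<omega>" if "\<omega> \<in> space M" for \<omega>
      using a C[of \<omega>] that by (cases "\<omega> \<in> B") (auto simp: abs_le_iff)
  qed
  also have "\<dots> = a + 2 * C * measure M B"
    by (subst Bochner_Integration.integral_add) (auto simp: emeasure_eq_measure prob_space)
  finally show ?thesis .
qed

text \<open>For Lipschitz minorants \<open>g k\<close> of \<open>f\<close>, the expectations of
  \<open>f (X n)\<close> are eventually above the limit of those of \<open>g k (X n)\<close>, up to
  any error, and by dominated convergence that limit is close to the expectation of
  \<open>f (Y)\<close> for suitable \<open>k\<close>. This gives the lower bound; applying it to
  \<open>- f\<close> gives the upper one. Measurability is needed to make the Bochner integrals
  monotone.\<close>

lemma weak_conv_K20I: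
  assumes "prob_space M" "prob_space N"
    and X: "\<And>n \<omega>. X n \<omega> \<in> K20" and Y: "\<And>\<omega>. \<omega> \<in> space N \<Longrightarrow> Y \<omega> \<in> K20"
    and X_measurable: "\<And>f n. bcont_K20 f \<Longrightarrow> (\<lambda>\<omega>. f (X n \<omega>)) \<in> borel_measurable M"
    and Y_measurable: "\<And>f. bcont_K20 f \<Longrightarrow> (\<lambda>\<omega>. f (Y \<omega>)) \<in> borel_measurable N"
    and lip: "\<And>f C L. lip_K20 f C L \<Longrightarrow>
      (\<lambda>n. integral\<^sup>L M (\<lambda>\<omega>. f (X n \<omega>))) \<longlonglongrightarrow> integral\<^sup>L N (\<lambda>\<omega>. f (Y \<omega>))"
  shows "weak_conv_K20 M X N Y"
proof -
  interpret M: prob_space M by fact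
  interpret N: prob_space N by fact
  have int_M: "integrable M (\<lambda>\<omega>. f (X n \<omega>))" if f: "bcont_K20 f" for f n
  proof -
    obtain C where "\<And>A. A \<in> K20 \<Longrightarrow> \<bar>f A\<bar> \<le> C" using f unfolding bcont_K20_def by blast
    then show ?thesis
      using X X_measurable[OF f] by (intro M.integrable_const_bound[of _ C]) auto
  qed
  have int_N: "integrable N (\<lambda>\<omega>. f (Y \<omega>))" if f: "bcont_K20 f" for f
  proof -
    obtain C where "\<And>A. A \<in> K20 \<Longrightarrow> \<bar>f A\<bar> \<le> C" using f unfolding bcont_K20_def by blast
    then show ?thesis
      using Y Y_measurable[OF f] by (intro N.integrable_const_bound[of _ C]) auto
  qed
  have lower: "\<forall>\<^sub>F n in sequentially. integral\<^sup>L N (\<lambda>\<omega>. f (Y \<omega>)) - e < integral\<^sup>L M (\<lambda>\<omega>. f (X n \<omega>))"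
    if f: "bcont_K20 f" and e: "e > 0" for f e
  proof -
    obtain g C where g: "\<And>k::nat. lip_K20 (g k) C (real k)"
      "\<And>k A. A \<in> K20 \<Longrightarrow> g k A \<le> f A" "\<And>A. A \<in> K20 \<Longrightarrow> (\<lambda>k. g k A) \<longlonglongrightarrow> f A"
      using lipschitz_minorants[OF f] by metis
    note gb = lip_K20_imp_bcont_K20[OF g(1)]
    have "(\<lambda>k. integral\<^sup>L N (\<lambda>\<omega>. g k (Y \<omega>))) \<longlonglongrightarrow> integral\<^sup>L N (\<lambda>\<omega>. f (Y \<omega>))"
    proof (rule integral_dominated_convergence[where w="\<lambda>_. C"])
      show "AE \<omega> in N. norm (g k (Y \<omega>)) \<le> C" for k
        using g(1)[of k] Y by (auto simp: lip_K20_def intro!: AE_I2)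
    qed (auto intro!: AE_I2 g(3) Y Y_measurable gb f)
    then have "\<forall>\<^sub>F k in sequentially. integral\<^sup>L N (\<lambda>\<omega>. f (Y \<omega>)) - e < integral\<^sup>L N (\<lambda>\<omega>. g k (Y \<omega>))"
      using e by (intro order_tendstoD) auto
    then obtain k where k: "integral\<^sup>L N (\<lambda>\<omega>. f (Y \<omega>)) - e < integral\<^sup>L N (\<lambda>\<omega>. g k (Y \<omega>))"
      by (auto simp: eventually_sequentially)
    from order_tendstoD(1)[OF lip[OF g(1)] k] show ?thesis
    proof eventually_elim
      case (elim n)
      have "integral\<^sup>L M (\<lambda>\<omega>. g k (X n \<omega>)) \<le> integral\<^sup>L M (\<lambda>\<omega>. f (X n \<omega>))"
        by (intro integral_mono int_M gb f g(2) X)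
      with elim show ?case by simp
    qed
  qed
  show ?thesis
    unfolding weak_conv_K20_def
  proof (intro allI impI)
    fix f assume f: "bcont_K20 f"
    have f': "bcont_K20 (\<lambda>A. - f A)"
      using f unfolding bcont_K20_def by (simp add: abs_minus_commute)
    show "(\<lambda>n. integral\<^sup>L M (\<lambda>\<omega>. f (X n \<omega>))) \<longlonglongrightarrow> integral\<^sup>L N (\<lambda>\<omega>. f (Y \<omega>))"
    proof (rule tendstoI)
      fix e :: real assume e: "e > 0"
      show "\<forall>\<^sub>F n in sequentially. dist (integral\<^sup>L M (\<lambda>\<omega>. f (X n \<omega>))) (integral\<^sup>L N (\<lambda>\<omega>. f (Y \<omega>))) < e"
        using lower[OF f e] lower[OF f' e]
        by eventually_elim (simp add: dist_real_def abs_less_iff)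
    qed
  qed
qed

section \<open>Sums of independent random variables\<close>

text \<open>Elements of a \<open>PiM\<close> space over \<open>I\<close> have the constant value
  \<open>undefined\<close> off \<open>I\<close>, so every coordinate map is measurable, not only
  those in \<open>I\<close>. Functions continuous on the full function space can thus be integrated
  against product measures over \<open>I\<close>.\<close>

lemma measurable_PiM_borel_coordinatewise:
  fixes I :: "'i::countable set"
  shows "(\<lambda>x. x) \<in> borel_measurable (PiM I (\<lambda>_. borel :: 'b::second_countable_topology measure))"
proof (rule measurable_coordinatewise_then_product)
  fix i
  show "(\<lambda>x. x i) \<in> borel_measurable (PiM I (\<lambda>_. borel :: 'b measure))"
  proof (cases "i \<in> I")
    case False
    then have "x i = undefined" if "x \<in> space (PiM I (\<lambda>_. borel :: 'b measure))" for x
      using that by (auto simp: space_PiM PiE_def extensional_def)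
    then show ?thesis
      using measurable_cong[of "PiM I (\<lambda>_. borel)" "\<lambda>x. x i" "\<lambda>_. undefined :: 'b" borel] by simp
  qed simp
qed

text \<open>The right-hand side sees only the marginal laws, so independent families living on
  different probability spaces can be compared through it.\<close>

lemma (in prob_space) expectation_indep_vars:
  fixes X :: "'i::countable \<Rightarrow> 'a \<Rightarrow> 'b::second_countable_topology"
    and G :: "('i \<Rightarrow> 'b) \<Rightarrow> real"
  assumes "I \<noteq> {}" and X: "\<And>i. X i \<in> borel_measurable M" and ind: "indep_vars (\<lambda>_. borel) X I"
    and G: "G \<in> borel_measurable borel"
  shows "expectation (\<lambda>\<omega>. G (\<lambda>i\<in>I. X i \<omega>)) = integral\<^sup>L (PiM I (\<lambda>i. distr M borel (X i))) G"
proof -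
  have G': "G \<in> borel_measurable (PiM I (\<lambda>_. borel))"
    by (rule measurable_compose[OF measurable_PiM_borel_coordinatewise G])
  have "expectation (\<lambda>\<omega>. G (\<lambda>i\<in>I. X i \<omega>))
      = integral\<^sup>L (distr M (PiM I (\<lambda>_. borel)) (\<lambda>\<omega>. \<lambda>i\<in>I. X i \<omega>)) G"
    by (subst integral_distr[OF _ G']) (auto intro!: measurable_restrict X)
  also have "distr M (PiM I (\<lambda>_. borel)) (\<lambda>\<omega>. \<lambda>i\<in>I. X i \<omega>) = PiM I (\<lambda>i. distr M borel (X i))"
    using indep_vars_iff_distr_eq_PiM[OF \<open>I \<noteq> {}\<close>, of X "\<lambda>_. borel"] X ind by auto
  finally show ?thesis .
qed

lemma (in prob_space) indep_vars_reindex: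
  assumes "inj h" "indep_vars M' X UNIV"
  shows "indep_vars (\<lambda>i. M' (h i)) (\<lambda>i. X (h i)) UNIV"
proof -
  have 1: "\<And>i. X i \<in> measurable M (M' i)" using assms(2) by (auto simp: indep_vars_def)
  show ?thesis
    unfolding indep_vars_def2
  proof (intro conjI ballI indep_setsI)
    show "random_variable (M' (h i)) (X (h i))" for i by (rule 1)
    show "{X (h i) -` A \<inter> space M |A. A \<in> sets (M' (h i))} \<subseteq> events" for i
      using 1[of "h i"] by (auto intro: measurable_sets)
    fix A J assume J: "J \<noteq> {}" "J \<subseteq> UNIV" "finite J"
      and A: "\<forall>j\<in>J. A j \<in> {X (h j) -` A \<inter> space M |A. A \<in> sets (M' (h j))}"
    have inj: "inj_on h J" using assms(1) by (auto intro: inj_on_subset)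
    from bchoice[of J, OF A[simplified mem_Collect_eq]] obtain B where
      B: "\<forall>j\<in>J. A j = X (h j) -` B j \<inter> space M \<and> B j \<in> sets (M' (h j))" by auto
    \<comment> \<open>Independence of \<open>X\<close> is applied on the image of \<open>J\<close>
      under \<open>h\<close>, so the sets are relabelled through \<open>inv h\<close>.\<close>
    let ?B = "\<lambda>i. B (inv h i)"
    have *: "inv h (h j) = j" for j using assms(1) by simp
    have "prob (\<Inter>i\<in>h ` J. X i -` ?B i \<inter> space M) = (\<Prod>i\<in>h ` J. prob (X i -` ?B i \<inter> space M))"
      using J B by (intro indep_varsD[OF assms(2)]) (auto simp: *)
    moreover have "(\<Inter>i\<in>h ` J. X i -` ?B i \<inter> space M) = (\<Inter>j\<in>J. A j)"
      using B by (auto simp: * image_image)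
    moreover have "(\<Prod>i\<in>h ` J. prob (X i -` ?B i \<inter> space M)) = (\<Prod>j\<in>J. prob (A j))"
      using B by (simp add: prod.reindex[OF inj] * o_def cong: prod.cong)
    ultimately show "prob (\<Inter>j\<in>J. A j) = (\<Prod>j\<in>J. prob (A j))" by simp
  qed
qed

text \<open>The event on the left is split according to the first index at which the partial sum
  exceeds the level.\<close>

lemma (in prob_space) Ottaviani_inequality:
  fixes X :: "nat \<Rightarrow> 'a \<Rightarrow> real"
  assumes ind: "indep_vars (\<lambda>_. borel) X UNIV"
    and c: "\<And>r. r \<le> q \<Longrightarrow> prob {\<omega>\<in>space M. \<bar>\<Sum>i\<in>{r..<q}. X i \<omega>\<bar> > a} \<le> c"
  shows "(1 - c) * prob {\<omega>\<in>space M. \<exists>r\<le>q. \<bar>\<Sum>i<r. X i \<omega>\<bar> > a + b}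
    \<le> prob {\<omega>\<in>space M. \<bar>\<Sum>i<q. X i \<omega>\<bar> > b}"
proof -
  have X[measurable]: "\<And>i. X i \<in> borel_measurable M" using ind by (auto simp: indep_vars_def2)
  define first where "first r x \<longleftrightarrow> \<bar>\<Sum>i<r. x i\<bar> > a + b \<and> (\<forall>s<r. \<bar>\<Sum>i<s. x i\<bar> \<le> a + b)"
    for r :: nat and x :: "nat \<Rightarrow> real"
  define E where "E r = {\<omega>\<in>space M. first r (\<lambda>i. X i \<omega>)}" for r
  define F where "F r = {\<omega>\<in>space M. \<bar>\<Sum>i\<in>{r..<q}. X i \<omega>\<bar> \<le> a}" for r
  have [measurable]: "E r \<in> events" "F r \<in> events" for r
    unfolding E_def F_def first_def by measurable
  have disj: "disjoint_family_on E {..q}"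
    unfolding disjoint_family_on_def E_def first_def by (auto simp: not_less[symmetric] neq_iff)
  have un: "{\<omega>\<in>space M. \<exists>r\<le>q. \<bar>\<Sum>i<r. X i \<omega>\<bar> > a + b} = (\<Union>r\<le>q. E r)"
  proof (intro equalityI subsetI)
    fix \<omega> assume "\<omega> \<in> {\<omega>\<in>space M. \<exists>r\<le>q. \<bar>\<Sum>i<r. X i \<omega>\<bar> > a + b}"
    then obtain r where r: "\<omega> \<in> space M" "r \<le> q" "\<bar>\<Sum>i<r. X i \<omega>\<bar> > a + b" by auto
    let ?s = "LEAST r. \<bar>\<Sum>i<r. X i \<omega>\<bar> > a + b"
    have "\<bar>\<Sum>i<?s. X i \<omega>\<bar> > a + b" using r(3) by (rule LeastI)
    moreover have "?s \<le> q" using Least_le[of "\<lambda>r. \<bar>\<Sum>i<r. X i \<omega>\<bar> > a + b", OF r(3)] r(2) by linarith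
    moreover have "\<forall>s<?s. \<bar>\<Sum>i<s. X i \<omega>\<bar> \<le> a + b" using not_less_Least by (metis not_less)
    ultimately show "\<omega> \<in> (\<Union>r\<le>q. E r)" using r(1) unfolding E_def first_def by blast
  qed (auto simp: E_def first_def)
  \<comment> \<open>\<open>E r\<close> is determined by the variables with index below
    \<open>r\<close> and \<open>F r\<close> by those from \<open>r\<close> to \<open>q - 1\<close>:
    two disjoint index sets.\<close>
  have prod: "prob (E r \<inter> F r) = prob (E r) * prob (F r)" if "r \<le> q" for r
  proof -
    have iv: "indep_var (PiM {..<r} (\<lambda>_. borel)) (\<lambda>\<omega>. restrict (\<lambda>i. X i \<omega>) {..<r})
        (PiM {r..<q} (\<lambda>_. borel)) (\<lambda>\<omega>. restrict (\<lambda>i. X i \<omega>) {r..<q})"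
      by (intro indep_var_restrict[OF ind]) auto
    have m: "(\<lambda>x. \<Sum>i<s. x i) \<in> borel_measurable (PiM {..<r} (\<lambda>_. borel :: real measure))"
      if "s \<le> r" for s using that by (intro borel_measurable_sum measurable_component_singleton) auto
    have P: "{x \<in> space (PiM {..<r} (\<lambda>_. borel :: real measure)). first r x} \<in> sets (PiM {..<r} (\<lambda>_. borel :: real measure))"
      unfolding first_def
      using m by (intro pred_intros_logic sets.sets_Collect_conj sets.sets_Collect_countable_Ball
          borel_measurable_less borel_measurable_le sets.sets_Collect_finite_All) auto
    have Q: "{x \<in> space (PiM {r..<q} (\<lambda>_. borel)). \<bar>\<Sum>i\<in>{r..<q}. x i\<bar> \<le> a} \<in> sets (PiM {r..<q} (\<lambda>_. borel :: real measure))"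
      by measurable
    have *: "first r (restrict (\<lambda>i. X i \<omega>) {..<r}) \<longleftrightarrow> first r (\<lambda>i. X i \<omega>)" for \<omega>
    proof -
      have "(\<Sum>i<s. restrict (\<lambda>i. X i \<omega>) {..<r} i) = (\<Sum>i<s. X i \<omega>)" if "s \<le> r" for s
        using that by (intro sum.cong) auto
      then show ?thesis unfolding first_def by simp
    qed
    have "prob ((\<lambda>x. (restrict (\<lambda>i. X i x) {..<r}, restrict (\<lambda>i. X i x) {r..<q})) -`
        ({x \<in> space (PiM {..<r} (\<lambda>_. borel)). first r x} \<times>
         {x \<in> space (PiM {r..<q} (\<lambda>_. borel)). \<bar>\<Sum>i\<in>{r..<q}. x i\<bar> \<le> a}) \<inter> space M) =
      prob ((\<lambda>\<omega>. restrict (\<lambda>i. X i \<omega>) {..<r}) -` {x \<in> space (PiM {..<r} (\<lambda>_. borel)). first r x} \<inter> space M) *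
      prob ((\<lambda>\<omega>. restrict (\<lambda>i. X i \<omega>) {r..<q}) -` {x \<in> space (PiM {r..<q} (\<lambda>_. borel)). \<bar>\<Sum>i\<in>{r..<q}. x i\<bar> \<le> a} \<inter> space M)"
      by (rule indep_varD[OF iv P Q])
    also have "((\<lambda>\<omega>. restrict (\<lambda>i. X i \<omega>) {..<r}) -` {x \<in> space (PiM {..<r} (\<lambda>_. borel)). first r x} \<inter> space M) = E r"
      by (auto simp: E_def * space_PiM)
    also have "((\<lambda>\<omega>. restrict (\<lambda>i. X i \<omega>) {r..<q}) -` {x \<in> space (PiM {r..<q} (\<lambda>_. borel)). \<bar>\<Sum>i\<in>{r..<q}. x i\<bar> \<le> a} \<inter> space M) = F r"
      by (auto simp: F_def space_PiM)
    also have "((\<lambda>x. (restrict (\<lambda>i. X i x) {..<r}, restrict (\<lambda>i. X i x) {r..<q})) -`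
        ({x \<in> space (PiM {..<r} (\<lambda>_. borel)). first r x} \<times>
         {x \<in> space (PiM {r..<q} (\<lambda>_. borel)). \<bar>\<Sum>i\<in>{r..<q}. x i\<bar> \<le> a}) \<inter> space M) = E r \<inter> F r"
      by (auto simp: E_def F_def * space_PiM)
    finally show ?thesis .
  qed
  have Fge: "1 - c \<le> prob (F r)" if "r \<le> q" for r
  proof -
    have "prob (F r) = 1 - prob (space M - F r)" by (subst prob_compl) auto
    also have "space M - F r = {\<omega>\<in>space M. \<bar>\<Sum>i\<in>{r..<q}. X i \<omega>\<bar> > a}" by (auto simp: F_def)
    finally show ?thesis using c[OF that] by simp
  qed
  have "(1 - c) * prob {\<omega>\<in>space M. \<exists>r\<le>q. \<bar>\<Sum>i<r. X i \<omega>\<bar> > a + b} = (1 - c) * (\<Sum>r\<le>q. prob (E r))"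
    unfolding un using disj by (subst finite_measure_finite_Union) auto
  also have "\<dots> \<le> (\<Sum>r\<le>q. prob (E r \<inter> F r))"
    unfolding sum_distrib_left
    by (intro sum_mono) (auto simp: prod mult.commute[of "prob (E _)"] intro!: mult_right_mono Fge)
  also have "\<dots> = prob (\<Union>r\<le>q. E r \<inter> F r)"
    using disj by (subst finite_measure_finite_Union) (auto simp: disjoint_family_on_def)
  also have "\<dots> \<le> prob {\<omega>\<in>space M. \<bar>\<Sum>i<q. X i \<omega>\<bar> > b}"
  proof (rule finite_measure_mono)
    show "(\<Union>r\<le>q. E r \<inter> F r) \<subseteq> {\<omega>\<in>space M. \<bar>\<Sum>i<q. X i \<omega>\<bar> > b}"
    proof
      fix \<omega> assume "\<omega> \<in> (\<Union>r\<le>q. E r \<inter> F r)"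
      then obtain r where r: "r \<le> q" "\<omega> \<in> E r" "\<omega> \<in> F r" by auto
      \<comment> \<open>At the first passage the partial sum exceeds \<open>a + b\<close> in
        absolute value and the remaining increments sum to at most \<open>a\<close>, so the full sum
        still exceeds \<open>b\<close>.\<close>
      have "(\<Sum>i<q. X i \<omega>) = (\<Sum>i<r. X i \<omega>) + (\<Sum>i\<in>{r..<q}. X i \<omega>)"
        using r(1) by (metis lessThan_atLeast0 sum.atLeastLessThan_concat zero_le)
      with r(2,3) show "\<omega> \<in> {\<omega>\<in>space M. \<bar>\<Sum>i<q. X i \<omega>\<bar> > b}"
        by (auto simp: E_def F_def first_def)
    qed
  qed measurable
  finally show ?thesis .
qed

section \<open>Second moments, maximal inequality and equal laws of blocks\<close>

lemma (in prob_space) second_moment_sum_indep: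
  fixes X :: "nat \<Rightarrow> 'a \<Rightarrow> real"
  assumes ind: "indep_vars (\<lambda>_. borel) X UNIV" and int: "\<And>i. integrable M (\<lambda>\<omega>. (X i \<omega>)\<^sup>2)"
    and mean: "\<And>i. expectation (X i) = 0" and var: "\<And>i. expectation (\<lambda>\<omega>. (X i \<omega>)\<^sup>2) = v"
    and "finite I"
  shows "integrable M (\<lambda>\<omega>. (\<Sum>i\<in>I. X i \<omega>)\<^sup>2)"
    and "expectation (\<lambda>\<omega>. (\<Sum>i\<in>I. X i \<omega>)\<^sup>2) = real (card I) * v"
proof -
  have X[measurable]: "\<And>i. X i \<in> borel_measurable M" using ind by (auto simp: indep_vars_def2)
  have intX: "integrable M (X i)" for i by (rule square_integrable_imp_integrable[OF X int])
  have "integrable M (\<lambda>\<omega>. (\<Sum>i\<in>I. X i \<omega>)\<^sup>2) \<and>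
      expectation (\<lambda>\<omega>. (\<Sum>i\<in>I. X i \<omega>)\<^sup>2) = real (card I) * v"
    using \<open>finite I\<close>
  proof (induction I rule: finite_induct)
    case (insert j I)
    let ?S = "\<lambda>\<omega>. \<Sum>i\<in>I. X i \<omega>"
    have iv: "indep_var borel (X j) borel ?S"
      by (rule indep_vars_sum[OF insert(1,2) indep_vars_subset[OF ind]]) simp
    have intS: "integrable M ?S" by (simp add: intX)
    have 1: "integrable M (\<lambda>\<omega>. X j \<omega> * ?S \<omega>)"
      by (rule indep_var_integrable[OF iv intX intS])
    have 2: "expectation (\<lambda>\<omega>. X j \<omega> * ?S \<omega>) = 0"
      using indep_var_lebesgue_integral[OF iv intX intS] mean by simp
    have eq: "(\<Sum>i\<in>insert j I. X i \<omega>)\<^sup>2 = (X j \<omega>)\<^sup>2 + ((?S \<omega>)\<^sup>2 + 2 * (X j \<omega> * ?S \<omega>))" for \<omega>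
      using insert by (simp add: power2_sum algebra_simps)
    show ?case
      unfolding eq using insert int 1 2 var[of j] by (simp add: algebra_simps)
  qed simp
  then show "integrable M (\<lambda>\<omega>. (\<Sum>i\<in>I. X i \<omega>)\<^sup>2)"
    "expectation (\<lambda>\<omega>. (\<Sum>i\<in>I. X i \<omega>)\<^sup>2) = real (card I) * v" by auto
qed

lemma (in prob_space) prob_sum_indep_gt_le:
  fixes X :: "nat \<Rightarrow> 'a \<Rightarrow> real"
  assumes ind: "indep_vars (\<lambda>_. borel) X UNIV" and int: "\<And>i. integrable M (\<lambda>\<omega>. (X i \<omega>)\<^sup>2)"
    and mean: "\<And>i. expectation (X i) = 0" and var: "\<And>i. expectation (\<lambda>\<omega>. (X i \<omega>)\<^sup>2) = v"
    and I: "finite I" and a: "a > 0"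
  shows "prob {\<omega>\<in>space M. \<bar>\<Sum>i\<in>I. X i \<omega>\<bar> > a} \<le> real (card I) * v / a\<^sup>2"
proof -
  have X[measurable]: "\<And>i. X i \<in> borel_measurable M" using ind by (auto simp: indep_vars_def2)
  have intX: "integrable M (X i)" for i by (rule square_integrable_imp_integrable[OF X int])
  let ?S = "\<lambda>\<omega>. \<Sum>i\<in>I. X i \<omega>"
  have ES: "expectation ?S = 0" by (simp add: intX mean)
  have "prob {\<omega>\<in>space M. \<bar>?S \<omega>\<bar> > a} \<le> prob {\<omega>\<in>space M. \<bar>?S \<omega> - expectation ?S\<bar> \<ge> a}"
    unfolding ES by (intro finite_measure_mono) auto
  also have "\<dots> \<le> variance ?S / a\<^sup>2"
    by (rule Chebyshev_inequality[OF _ second_moment_sum_indep(1)[OF ind int mean var I] a]) simp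
  also have "variance ?S = real (card I) * v"
    unfolding ES using second_moment_sum_indep(2)[OF ind int mean var I] by simp
  finally show ?thesis .
qed

text \<open>The condition on \<open>q\<close> makes Chebyshev's bound at most 1/2 for every final
  segment of the sum. Ottaviani's inequality with \<open>b = a\<close> and \<open>c = 1/2\<close>
  then costs a factor 2 in the level and a factor 2 in the probability.\<close>

lemma (in prob_space) maximal_inequality:
  fixes X :: "nat \<Rightarrow> 'a \<Rightarrow> real"
  assumes ind: "indep_vars (\<lambda>_. borel) X UNIV" and int: "\<And>i. integrable M (\<lambda>\<omega>. (X i \<omega>)\<^sup>2)"
    and mean: "\<And>i. expectation (X i) = 0" and var: "\<And>i. expectation (\<lambda>\<omega>. (X i \<omega>)\<^sup>2) = v"
    and a: "a > 0" and q: "2 * real q * v \<le> a\<^sup>2"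
  shows "prob {\<omega>\<in>space M. \<exists>r\<le>q. \<bar>\<Sum>i<r. X i \<omega>\<bar> > 2 * a} \<le>
    2 * prob {\<omega>\<in>space M. \<bar>\<Sum>i<q. X i \<omega>\<bar> > a}"
proof -
  have "v \<ge> 0" using var[of 0] Bochner_Integration.integral_nonneg[of M "\<lambda>\<omega>. (X 0 \<omega>)\<^sup>2"] by simp
  have "prob {\<omega>\<in>space M. \<bar>\<Sum>i\<in>{r..<q}. X i \<omega>\<bar> > a} \<le> 1 / 2" for r
  proof -
    have "prob {\<omega>\<in>space M. \<bar>\<Sum>i\<in>{r..<q}. X i \<omega>\<bar> > a} \<le> real (card {r..<q}) * v / a\<^sup>2"
      by (rule prob_sum_indep_gt_le[OF ind int mean var _ a]) simp
    also have "\<dots> \<le> real q * v / a\<^sup>2"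
      using \<open>v \<ge> 0\<close> by (intro divide_right_mono mult_right_mono) auto
    also have "\<dots> \<le> 1 / 2" using q a by (simp add: field_simps)
    finally show ?thesis .
  qed
  from Ottaviani_inequality[OF ind this, where b=a] show ?thesis by simp
qed

text \<open>A weak law for the running maximum, used for the first coordinate. The level is of order
  \<open>n\<close> and not \<open>sqrt n\<close>, so Chebyshev's inequality is strong enough
  here.\<close>

lemma (in prob_space) max_sum_negligible:
  fixes X :: "nat \<Rightarrow> 'a \<Rightarrow> real"
  assumes ind: "indep_vars (\<lambda>_. borel) X UNIV" and int: "\<And>i. integrable M (\<lambda>\<omega>. (X i \<omega>)\<^sup>2)"
    and mean: "\<And>i. expectation (X i) = 0" and var: "\<And>i. expectation (\<lambda>\<omega>. (X i \<omega>)\<^sup>2) = v"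
    and e: "e > 0"
  shows "(\<lambda>n. prob {\<omega>\<in>space M. \<exists>r\<le>n. \<bar>\<Sum>i<r. X i \<omega>\<bar> > e * real n}) \<longlonglongrightarrow> 0"
proof (rule tendsto_sandwich[OF _ _ tendsto_const])
  show "(\<lambda>n. (8 * v / e\<^sup>2) * (1 / real n)) \<longlonglongrightarrow> 0"
    by (intro tendsto_mult_right_zero lim_1_over_n)
  \<comment> \<open>From \<open>n0\<close> on, the condition
    \<open>2 * n * v \<le> (e * n / 2)\<^sup>2\<close> of \<open>maximal_inequality\<close> holds;
    Chebyshev's bound at level \<open>e * n / 2\<close>, doubled, is the majorant
    \<open>8 * v / (e\<^sup>2 * n)\<close>.\<close>
  obtain n0 :: nat where n0: "real n0 > 8 * v / e\<^sup>2" using reals_Archimedean2 by blast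
  show "\<forall>\<^sub>F n in sequentially. prob {\<omega>\<in>space M. \<exists>r\<le>n. \<bar>\<Sum>i<r. X i \<omega>\<bar> > e * real n} \<le>
      (8 * v / e\<^sup>2) * (1 / real n)"
    using eventually_ge_at_top[of n0] eventually_gt_at_top[of 0]
  proof eventually_elim
    case (elim n)
    have "8 * v \<le> e\<^sup>2 * real n0" using n0 e by (simp add: field_simps)
    also have "\<dots> \<le> e\<^sup>2 * real n" using elim by (intro mult_left_mono) auto
    finally have "8 * v * real n \<le> e\<^sup>2 * real n * real n" by (rule mult_right_mono) simp
    then have q: "2 * real n * v \<le> (e * real n / 2)\<^sup>2" by (simp add: power2_eq_square algebra_simps)
    have a: "e * real n / 2 > 0" using e elim by simp
    have "prob {\<omega>\<in>space M. \<exists>r\<le>n. \<bar>\<Sum>i<r. X i \<omega>\<bar> > 2 * (e * real n / 2)} \<le>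
      2 * prob {\<omega>\<in>space M. \<bar>\<Sum>i<n. X i \<omega>\<bar> > e * real n / 2}"
      by (rule maximal_inequality[OF ind int mean var a q])
    also have "\<dots> \<le> 2 * (real (card {..<n}) * v / (e * real n / 2)\<^sup>2)"
      by (intro mult_left_mono prob_sum_indep_gt_le[OF ind int mean var _ a]) auto
    also have "\<dots> = (8 * v / e\<^sup>2) * (1 / real n)"
      using elim e by (simp add: field_simps power2_eq_square)
    finally show ?case by simp
  qed
qed simp

text \<open>By independence and equal marginals, both laws come from the same product measure with
  \<open>q\<close> factors. The empty sum is treated apart because the product description asks for
  a nonempty index set.\<close>

lemma (in prob_space) distr_block_sum:
  fixes Y :: "nat \<Rightarrow> 'a \<Rightarrow> real"
  assumes ind: "indep_vars (\<lambda>_. borel) Y UNIV" and distr: "\<And>i. distr M borel (Y i) = distr M borel (Y 0)"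
  shows "distr M borel (\<lambda>\<omega>. \<Sum>k\<in>{s..<s + q}. Y k \<omega>) = distr M borel (\<lambda>\<omega>. \<Sum>k<q. Y k \<omega>)"
proof (cases "q = 0")
  case False
  have Y[measurable]: "\<And>i. Y i \<in> borel_measurable M" using ind by (auto simp: indep_vars_def2)
  have prob: "prob ((\<lambda>\<omega>. \<Sum>k\<in>{s..<s + q}. Y k \<omega>) -` A \<inter> space M) =
      integral\<^sup>L (PiM {..<q} (\<lambda>_. distr M borel (Y 0))) (\<lambda>x. indicator A (\<Sum>k<q. x k))"
    if A: "A \<in> sets borel" for A s
  proof -
    let ?G = "\<lambda>x::nat \<Rightarrow> real. indicator A (\<Sum>k<q. x k) :: real"
    have "(\<lambda>x::nat \<Rightarrow> real. \<Sum>k<q. x k) \<in> borel_measurable borel"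
      by (intro borel_measurable_continuous_onI continuous_intros continuous_on_product_coordinates)
    then have G: "?G \<in> borel_measurable borel"
      using A by (rule measurable_compose[OF _ borel_measurable_indicator])
    have ind': "indep_vars (\<lambda>_. borel) (\<lambda>k. Y (s + k)) {..<q}"
      by (intro indep_vars_subset[OF indep_vars_reindex[OF _ ind]]) auto
    have "(\<Sum>k\<in>{s..<s + q}. Y k \<omega>) = (\<Sum>k<q. Y (s + k) \<omega>)" for \<omega>
      using sum.shift_bounds_nat_ivl[of "\<lambda>k. Y k \<omega>" 0 s q] by (simp add: lessThan_atLeast0 add.commute)
    then have "indicator ((\<lambda>\<omega>. \<Sum>k\<in>{s..<s + q}. Y k \<omega>) -` A \<inter> space M) \<omega> = ?G (\<lambda>k\<in>{..<q}. Y (s + k) \<omega>)"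
      if "\<omega> \<in> space M" for \<omega> using that by (simp add: indicator_def)
    then have "expectation (indicator ((\<lambda>\<omega>. \<Sum>k\<in>{s..<s + q}. Y k \<omega>) -` A \<inter> space M)) =
        expectation (\<lambda>\<omega>. ?G (\<lambda>k\<in>{..<q}. Y (s + k) \<omega>))"
      by (rule Bochner_Integration.integral_cong[OF refl])
    then have "prob ((\<lambda>\<omega>. \<Sum>k\<in>{s..<s + q}. Y k \<omega>) -` A \<inter> space M) = expectation (\<lambda>\<omega>. ?G (\<lambda>k\<in>{..<q}. Y (s + k) \<omega>))"
      by simp
    also have "\<dots> = integral\<^sup>L (PiM {..<q} (\<lambda>k. distr M borel (Y (s + k)))) ?G"
      using False by (intro expectation_indep_vars ind' G) auto
    also have "(\<lambda>k. distr M borel (Y (s + k))) = (\<lambda>_. distr M borel (Y 0))"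
      by (rule ext) (rule distr)
    finally show ?thesis .
  qed
  show ?thesis
  proof (rule measure_eqI)
    fix A assume "A \<in> sets (distr M borel (\<lambda>\<omega>. \<Sum>k\<in>{s..<s + q}. Y k \<omega>))"
    then have A: "A \<in> sets borel" by simp
    show "emeasure (distr M borel (\<lambda>\<omega>. \<Sum>k\<in>{s..<s + q}. Y k \<omega>)) A =
        emeasure (distr M borel (\<lambda>\<omega>. \<Sum>k<q. Y k \<omega>)) A"
      using prob[OF A, of s] prob[OF A, of 0] A
      by (simp add: emeasure_distr emeasure_eq_measure lessThan_atLeast0)
  qed simp
qed simp

section \<open>Standardised walks: Gaussian tails and modulus of continuity\<close>

locale standard_iid = prob_space +
  fixes Y :: "nat \<Rightarrow> 'a \<Rightarrow> real"
  assumes ind: "indep_vars (\<lambda>_. borel) Y UNIV"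
    and distr: "\<And>i. distr M borel (Y i) = distr M borel (Y 0)"
    and square_integrable: "\<And>i. integrable M (\<lambda>\<omega>. (Y i \<omega>)\<^sup>2)"
    and mean: "\<And>i. expectation (Y i) = 0"
    and var: "\<And>i. expectation (\<lambda>\<omega>. (Y i \<omega>)\<^sup>2) = 1"
begin

lemma measurable_Y[measurable]: "Y i \<in> borel_measurable M"
  using ind by (auto simp: indep_vars_def2)

lemma CLT: "weak_conv_m (\<lambda>n. distr M borel (\<lambda>\<omega>. (\<Sum>i<n. Y i \<omega>) / sqrt n)) std_normal_distribution"
  using central_limit_theorem_zero_mean[OF ind mean _ square_integrable _ distr, of 1] mean var by simp

text \<open>No fourth moment of \<open>Y\<close> is assumed. The function
  \<open>min 1 ((x / a) ^ 4)\<close> is bounded and continuous and dominates the indicator of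
  \<open>\<bar>x\<bar> > a\<close>; by the central limit theorem its expectation tends to the
  Gaussian one, which is at most \<open>3 / a ^ 4\<close>. The constant 4 leaves a strict gap, so
  the bound holds for all large \<open>q\<close>.\<close>

lemma eventually_tail_le:
  assumes a: "a > 0"
  shows "\<forall>\<^sub>F q in sequentially. prob {\<omega>\<in>space M. \<bar>\<Sum>i<q. Y i \<omega>\<bar> > a * sqrt q} \<le> 4 / a ^ 4"
proof -
  let ?g = "\<lambda>x. min 1 ((x / a) ^ 4)"
  let ?\<mu> = "\<lambda>n. distr M borel (\<lambda>\<omega>. (\<Sum>i<n. Y i \<omega>) / sqrt (real n))"
  interpret std: real_distribution std_normal_distribution by (rule real_dist_normal_dist)
  have 4: "integral\<^sup>L std_normal_distribution (\<lambda>x. x ^ 4) = 3"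
    using std_normal_distribution_even_moments(1)[of 2] by (simp add: fact_numeral)
  have int: "integrable std_normal_distribution ?g"
    by (rule std.integrable_const_bound[of _ 1]) (auto simp: abs_le_iff min_def)
  have "(\<lambda>q. integral\<^sup>L (?\<mu> q) ?g) \<longlonglongrightarrow> integral\<^sup>L std_normal_distribution ?g"
  proof (rule weak_conv_imp_integral_bdd_continuous_conv[OF _ _ CLT])
    show "real_distribution (?\<mu> n)" for n by (rule real_distribution_distr) simp
    show "real_distribution std_normal_distribution" by (rule real_dist_normal_dist)
    show "isCont ?g x" for x using a by (intro continuous_intros) auto
    show "norm (?g x) \<le> 1" for x by (auto simp: abs_le_iff min_def)
  qed
  moreover have "integral\<^sup>L std_normal_distribution ?g \<le> integral\<^sup>L std_normal_distribution (\<lambda>x. x ^ 4 / a ^ 4)"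
    by (intro integral_mono int integrable_divide integrable_std_normal_distribution_moment)
      (auto simp: power_divide)
  then have "integral\<^sup>L std_normal_distribution ?g < 4 / a ^ 4"
    using 4 a by (simp add: less_le_trans divide_strict_right_mono order_le_less_trans)
  ultimately have "\<forall>\<^sub>F q in sequentially. integral\<^sup>L (?\<mu> q) ?g < 4 / a ^ 4"
    by (rule order_tendstoD)
  then show ?thesis
    using eventually_gt_at_top[of 0]
  proof eventually_elim
    case (elim q)
    let ?A = "{\<omega>\<in>space M. \<bar>\<Sum>i<q. Y i \<omega>\<bar> > a * sqrt q}"
    have "prob ?A = expectation (indicator ?A)" by simp
    also have "\<dots> \<le> expectation (\<lambda>\<omega>. ?g ((\<Sum>i<q. Y i \<omega>) / sqrt q))"
    proof (rule integral_mono)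
      show "integrable M (\<lambda>\<omega>. ?g ((\<Sum>i<q. Y i \<omega>) / sqrt q))"
        by (rule integrable_const_bound[of _ 1]) (auto simp: abs_le_iff min_def)
      fix \<omega>
      show "indicator ?A \<omega> \<le> ?g ((\<Sum>i<q. Y i \<omega>) / sqrt q)"
      proof (cases "\<omega> \<in> ?A")
        case True
        then have "1 \<le> \<bar>(\<Sum>i<q. Y i \<omega>) / sqrt q / a\<bar>"
          using a elim by (simp add: field_simps abs_mult)
        then have "1 \<le> \<bar>(\<Sum>i<q. Y i \<omega>) / sqrt q / a\<bar> ^ 4" by (rule one_le_power)
        then have "1 \<le> ((\<Sum>i<q. Y i \<omega>) / sqrt q / a) ^ 4" by (subst (asm) power_even_abs) auto
        then show ?thesis by (simp add: indicator_def del: divide_divide_eq_left)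
      qed (auto simp: min_def)
    qed (auto simp: integrable_indicator_iff emeasure_eq_measure)
    also have "\<dots> = integral\<^sup>L (?\<mu> q) ?g" by (subst integral_distr) auto
    finally show ?case using elim by simp
  qed
qed

lemma shift: "standard_iid M (\<lambda>i. Y (s + i))"
proof
  show "indep_vars (\<lambda>_. borel) (\<lambda>i. Y (s + i)) UNIV"
    by (rule indep_vars_reindex[OF _ ind]) simp
  show "distr M borel (Y (s + i)) = distr M borel (Y (s + 0))" for i
    using distr by metis
qed (auto simp: square_integrable mean var)

text \<open>With \<open>a = e * sqrt m / 2\<close> each block contributes at most
  \<open>2 * (4 / a ^ 4) = 128 / (e ^ 4 * m\<^sup>2)\<close>, and there are
  \<open>m + 1 \<le> 2 * m\<close> blocks. The fourth power is what leaves a factor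
  \<open>1 / m\<close> after the union. The lower bound on \<open>m\<close> is the condition of
  \<open>maximal_inequality\<close> at level \<open>e * sqrt n / 2\<close>.\<close>

lemma modulus_of_continuity:
  assumes e: "e > 0" and m: "m > 0" "real m \<ge> 8 / e\<^sup>2"
  shows "\<forall>\<^sub>F n in sequentially. prob {\<omega>\<in>space M. \<exists>j\<le>m. \<exists>r\<le>n div m.
      \<bar>\<Sum>k\<in>{j * (n div m)..<j * (n div m) + r}. Y k \<omega>\<bar> > e * sqrt n} \<le> 256 / (e ^ 4 * real m)"
proof -
  \<comment> \<open>Half the level \<open>e * sqrt n\<close> in units of \<open>sqrt q\<close>:
    since \<open>m * q \<le> n\<close> for \<open>q = n div m\<close>, the half level is at least
    \<open>?a * sqrt q\<close>.\<close>
  let ?a = "e * sqrt m / 2"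
  have a: "?a > 0" using e m by simp
  have lim: "filterlim (\<lambda>n. n div m) sequentially sequentially"
    using m by (intro filterlim_at_top_div_const_nat)
  from eventually_compose_filterlim[OF eventually_tail_le[OF a] lim] eventually_gt_at_top[of 0]
  show ?thesis
  proof eventually_elim
    case (elim n)
    define q where "q = n div m"
    have qm: "real q * real m \<le> real n"
      unfolding q_def of_nat_mult[symmetric] of_nat_le_iff by simp
    have sq: "sqrt m * sqrt q \<le> sqrt n"
      using qm by (simp add: real_sqrt_mult[symmetric] mult.commute)
    have b: "e * sqrt n / 2 > 0" using e elim by simp
    have "8 \<le> e\<^sup>2 * real m" using m(2) e by (simp add: field_simps)
    then have "8 * real q \<le> e\<^sup>2 * real m * real q" by (intro mult_right_mono) auto
    also have "\<dots> \<le> e\<^sup>2 * real n" using qm by (simp add: mult.assoc mult.commute[of "real m"] mult_left_mono)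
    finally have q2: "2 * real q * 1 \<le> (e * sqrt n / 2)\<^sup>2"
      by (simp add: power_mult_distrib power_divide)
    have block: "prob {\<omega>\<in>space M. \<exists>r\<le>q. \<bar>\<Sum>k\<in>{s..<s + r}. Y k \<omega>\<bar> > e * sqrt n} \<le> 2 * (4 / ?a ^ 4)" for s
    proof -
      interpret S: standard_iid M "\<lambda>i. Y (s + i)" by (rule shift)
      have eq: "(\<Sum>k\<in>{s..<s + r}. Y k \<omega>) = (\<Sum>k<r. Y (s + k) \<omega>)" for \<omega> r
        using sum.shift_bounds_nat_ivl[of "\<lambda>k. Y k \<omega>" 0 s r] by (simp add: lessThan_atLeast0 add.commute)
      have "prob {\<omega>\<in>space M. \<exists>r\<le>q. \<bar>\<Sum>k<r. Y (s + k) \<omega>\<bar> > 2 * (e * sqrt n / 2)} \<le>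
          2 * prob {\<omega>\<in>space M. \<bar>\<Sum>k<q. Y (s + k) \<omega>\<bar> > e * sqrt n / 2}"
        by (rule maximal_inequality[OF S.ind S.square_integrable S.mean S.var b q2])
      \<comment> \<open>Each block is replaced by the initial block, which has the same law, so one
        eventual tail bound serves all blocks at once.\<close>
      also have "prob {\<omega>\<in>space M. \<bar>\<Sum>k<q. Y (s + k) \<omega>\<bar> > e * sqrt n / 2} =
          measure (distr M borel (\<lambda>\<omega>. \<Sum>k\<in>{s..<s + q}. Y k \<omega>)) {x. \<bar>x\<bar> > e * sqrt n / 2}"
        unfolding eq by (subst measure_distr) (auto intro!: arg_cong[where f=prob])
      also have "\<dots> = prob {\<omega>\<in>space M. \<bar>\<Sum>k<q. Y k \<omega>\<bar> > e * sqrt n / 2}"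
        unfolding distr_block_sum[OF ind distr]
        by (subst measure_distr) (auto intro!: arg_cong[where f=prob])
      also have "\<dots> \<le> prob {\<omega>\<in>space M. \<bar>\<Sum>k<q. Y k \<omega>\<bar> > ?a * sqrt q}"
      proof (rule finite_measure_mono)
        have "?a * sqrt q \<le> e * sqrt n / 2" using sq e by (simp add: mult.assoc)
        then show "{\<omega>\<in>space M. \<bar>\<Sum>k<q. Y k \<omega>\<bar> > e * sqrt n / 2} \<subseteq> {\<omega>\<in>space M. \<bar>\<Sum>k<q. Y k \<omega>\<bar> > ?a * sqrt q}"
          by auto
      qed simp
      also have "\<dots> \<le> 4 / ?a ^ 4" using elim(1) by (simp add: q_def)
      finally show ?thesis unfolding eq by simp
    qed
    have "{\<omega>\<in>space M. \<exists>j\<le>m. \<exists>r\<le>q. \<bar>\<Sum>k\<in>{j * q..<j * q + r}. Y k \<omega>\<bar> > e * sqrt n} =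
        (\<Union>j\<le>m. {\<omega>\<in>space M. \<exists>r\<le>q. \<bar>\<Sum>k\<in>{j * q..<j * q + r}. Y k \<omega>\<bar> > e * sqrt n})" by auto
    also have "prob \<dots> \<le> (\<Sum>j\<le>m. prob {\<omega>\<in>space M. \<exists>r\<le>q. \<bar>\<Sum>k\<in>{j * q..<j * q + r}. Y k \<omega>\<bar> > e * sqrt n})"
      by (intro finite_measure_subadditive_finite) auto
    also have "\<dots> \<le> (\<Sum>j\<le>m. 2 * (4 / ?a ^ 4))" by (intro sum_mono block)
    also have "\<dots> = (real m + 1) * (128 / (e ^ 4 * (real m)\<^sup>2))"
      using m e by (simp add: power_divide power_mult_distrib power2_eq_square field_simps)
        (simp add: power4_eq_xxxx field_simps)
    also have "\<dots> \<le> (2 * real m) * (128 / (e ^ 4 * (real m)\<^sup>2))"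
      using m by (intro mult_right_mono) auto
    also have "\<dots> = 256 / (e ^ 4 * real m)"
      using m e by (simp add: power2_eq_square field_simps)
    finally show ?case by (simp add: q_def)
  qed
qed

end

section \<open>Convergence of the block increments\<close>

lemma tendsto_coordinatewise:
  fixes x :: "'c \<Rightarrow> 'i \<Rightarrow> 'b::topological_space"
  assumes "\<And>i. ((\<lambda>n. x n i) \<longlongrightarrow> l i) F"
  shows "(x \<longlongrightarrow> l) F"
  using limitin_componentwise[of "\<lambda>_. euclidean" UNIV x l F] assms
  by (simp add: euclidean_product_topology)

context standard_iid
begin

text \<open>By Skorohod's theorem the normalised block sums have versions that converge pointwise;
  independent copies of these versions live on a finite product space, where dominated
  convergence applies.\<close>

lemma block_increments_converge:
  fixes D :: "nat \<Rightarrow> 'b \<Rightarrow> real" and G :: "(nat \<Rightarrow> real) \<Rightarrow> real"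
  assumes G: "continuous_on UNIV G" "\<And>x. \<bar>G x\<bar> \<le> C" and m: "m > 0" and N: "prob_space N"
    and D: "\<And>i. D i \<in> borel_measurable N" "prob_space.indep_vars N (\<lambda>_. borel) D {..<m}"
    and normal: "\<And>i. distributed N lborel (D i) (normal_density 0 (sqrt (1 / real m)))"
  shows "(\<lambda>n. expectation (\<lambda>\<omega>. G (\<lambda>i\<in>{..<m}.
      (\<Sum>k\<in>{i * (n div m)..<i * (n div m) + n div m}. Y k \<omega>) / sqrt n))) \<longlonglongrightarrow>
    integral\<^sup>L N (\<lambda>\<omega>. G (\<lambda>i\<in>{..<m}. D i \<omega>))"
proof -
  interpret N: prob_space N by fact
  let ?\<mu> = "\<lambda>n. distr M borel (\<lambda>\<omega>. (\<Sum>i<n. Y i \<omega>) / sqrt (real n))"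
  have Gm[measurable]: "G \<in> borel_measurable borel"
    by (rule borel_measurable_continuous_onI[OF G(1)])
  have "real_distribution (?\<mu> n)" for n by (rule real_distribution_distr) simp
  from Skorohod[OF this real_dist_normal_dist CLT]
  obtain \<Omega> :: "real measure" and V :: "nat \<Rightarrow> real \<Rightarrow> real" and W :: "real \<Rightarrow> real" where
    "prob_space \<Omega>" and [measurable]: "\<And>n. V n \<in> borel_measurable \<Omega>" "W \<in> borel_measurable \<Omega>"
    and V: "\<And>n. distr \<Omega> borel (V n) = ?\<mu> n" and W: "distr \<Omega> borel W = std_normal_distribution"
    and lim: "\<And>u. u \<in> space \<Omega> \<Longrightarrow> (\<lambda>n. V n u) \<longlonglongrightarrow> W u" unfolding measurable_lborel1 by blast
  interpret \<Omega>: prob_space \<Omega> by fact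
  define q where "q n = n div m" for n
  \<comment> \<open>Converts the normalisation \<open>sqrt (q n)\<close>, natural for a block of
    length \<open>q n\<close>, into \<open>sqrt n\<close>. Its limit \<open>sqrt (1 / m)\<close> is
    the standard deviation of a Brownian increment over time \<open>1 / m\<close>.\<close>
  define c where "c n = sqrt (q n) / sqrt n" for n
  define \<xi> where "\<xi> n i \<omega> = (\<Sum>k\<in>{i * q n..<i * q n + q n}. Y k \<omega>) / sqrt n" for n i \<omega>
  define P where "P = PiM {..<m} (\<lambda>_. \<Omega>)"
  interpret P: prob_space P unfolding P_def by (intro prob_space_PiM \<Omega>.prob_space_axioms)
  have ne: "{..<m} \<noteq> {}" using m by auto
  \<comment> \<open>\<open>compose {..<m} f\<close> applies \<open>f\<close> in each coordinate and
    maps the product measure \<open>P\<close> to the product of the laws of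
    \<open>f\<close>.\<close>
  have transfer: "integral\<^sup>L (PiM {..<m} (\<lambda>_. distr \<Omega> borel f)) G = integral\<^sup>L P (\<lambda>u. G (compose {..<m} f u))"
    if f[measurable]: "f \<in> borel_measurable \<Omega>" for f
  proof -
    have "distr \<Omega> (distr \<Omega> borel f) f = distr \<Omega> borel f" by (rule distr_cong) auto
    then have 1: "PiM {..<m} (\<lambda>_. distr \<Omega> borel f) =
        distr P (PiM {..<m} (\<lambda>_. distr \<Omega> borel f)) (compose {..<m} f)"
      unfolding P_def
      using distr_PiM_finite_prob_space'[of "{..<m}" "\<lambda>_. \<Omega>" "\<lambda>_. distr \<Omega> borel f" f]
        \<Omega>.prob_space_distr[OF f] \<Omega>.prob_space_axioms by simp
    have 2: "compose {..<m} f \<in> measurable P (PiM {..<m} (\<lambda>_. distr \<Omega> borel f))"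
      unfolding compose_def P_def by (intro measurable_restrict) simp
    have 3: "G \<in> borel_measurable (PiM {..<m} (\<lambda>_. distr \<Omega> borel f))"
      using measurable_compose[OF measurable_PiM_borel_coordinatewise Gm, of "{..<m}"]
      by (subst measurable_cong_sets[OF sets_PiM_cong refl]) auto
    show ?thesis unfolding integral_distr[OF 2 3, symmetric] 1[symmetric] ..
  qed
  \<comment> \<open>The right-hand side does not involve \<open>i\<close>: blocks at all positions
    share one law, so a single variable \<open>V (q n)\<close> represents each of them.\<close>
  have \<xi>_law: "distr M borel (\<xi> n i) = distr \<Omega> borel (\<lambda>u. c n * V (q n) u)" for n i
  proof -
    have *: "(\<lambda>\<omega>. (\<Sum>k<q n. Y k \<omega>) / sqrt n) = (\<lambda>x. c n * x) \<circ> (\<lambda>\<omega>. (\<Sum>k<q n. Y k \<omega>) / sqrt (q n))"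
      by (auto simp: c_def)
    have "distr M borel (\<xi> n i) = distr (distr M borel (\<lambda>\<omega>. \<Sum>k\<in>{i * q n..<i * q n + q n}. Y k \<omega>)) borel (\<lambda>x. x / sqrt n)"
      unfolding \<xi>_def by (subst distr_distr) (auto simp: o_def)
    also have "\<dots> = distr M borel (\<lambda>\<omega>. (\<Sum>k<q n. Y k \<omega>) / sqrt n)"
      unfolding distr_block_sum[OF ind distr] by (subst distr_distr) (auto simp: o_def)
    also have "\<dots> = distr (?\<mu> (q n)) borel (\<lambda>x. c n * x)"
      unfolding * by (subst distr_distr) auto
    also have "\<dots> = distr \<Omega> borel (\<lambda>u. c n * V (q n) u)"
      unfolding V[symmetric] by (subst distr_distr) (auto simp: o_def)
    finally show ?thesis .
  qed
  have \<xi>_ind: "indep_vars (\<lambda>_. borel) (\<xi> n) {..<m}" for n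
  proof -
    have "disjoint_family_on (\<lambda>i. {i * q n..<i * q n + q n}) {..<m}"
      unfolding disjoint_family_on_def
    proof (intro ballI impI)
      fix i j :: nat assume "i \<noteq> j"
      then have "Suc i \<le> j \<or> Suc j \<le> i" by auto
      then have "Suc i * q n \<le> j * q n \<or> Suc j * q n \<le> i * q n" by (metis mult_le_mono1)
      then show "{i * q n..<i * q n + q n} \<inter> {j * q n..<j * q n + q n} = {}" by auto
    qed
    from indep_vars_restrict[OF ind _ this]
    have "indep_vars (\<lambda>i. PiM {i * q n..<i * q n + q n} (\<lambda>_. borel))
        (\<lambda>i \<omega>. restrict (\<lambda>k. Y k \<omega>) {i * q n..<i * q n + q n}) {..<m}" by simp
    then have "indep_vars (\<lambda>_. borel)
        (\<lambda>i \<omega>. (\<Sum>k\<in>{i * q n..<i * q n + q n}. restrict (\<lambda>k. Y k \<omega>) {i * q n..<i * q n + q n} k) / sqrt n) {..<m}"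
      by (rule indep_vars_compose2[where Y = "\<lambda>i x. (\<Sum>k\<in>{i * q n..<i * q n + q n}. x k) / sqrt n"])
        (intro borel_measurable_divide borel_measurable_sum measurable_component_singleton; simp)
    then show ?thesis unfolding \<xi>_def by simp
  qed
  have \<xi>_m: "\<xi> n i \<in> borel_measurable M" for n i unfolding \<xi>_def by measurable
  have E\<xi>: "expectation (\<lambda>\<omega>. G (\<lambda>i\<in>{..<m}. \<xi> n i \<omega>)) =
      integral\<^sup>L P (\<lambda>u. G (compose {..<m} (\<lambda>u. c n * V (q n) u) u))" for n
    unfolding expectation_indep_vars[OF ne \<xi>_m \<xi>_ind Gm] \<xi>_law by (rule transfer) simp
  have D_law: "distr N borel (D i) = distr \<Omega> borel (\<lambda>u. sqrt (1 / m) * W u)" for i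
  proof -
    \<comment> \<open>\<open>distributed\<close> pushes forward into \<open>lborel\<close>, the laws
      above into \<open>borel\<close>; only the sigma-algebra of the target matters, and the two
      agree.\<close>
    have "distributed \<Omega> lborel W std_normal_density"
      using W by (auto simp: distributed_def intro!: trans[OF distr_cong[of \<Omega> \<Omega> lborel borel W W]])
    from \<Omega>.normal_density_affine[OF this, of "sqrt (1 / m)" 0]
    have "distributed \<Omega> lborel (\<lambda>u. sqrt (1 / m) * W u) (normal_density 0 (sqrt (1 / m)))"
      using m by simp
    then have "distr \<Omega> lborel (\<lambda>u. sqrt (1 / m) * W u) = distr N lborel (D i)"
      using normal by (simp add: distributed_def)
    moreover have "distr \<Omega> lborel (\<lambda>u. sqrt (1 / m) * W u) = distr \<Omega> borel (\<lambda>u. sqrt (1 / m) * W u)"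
      "distr N lborel (D i) = distr N borel (D i)" by (auto intro!: distr_cong)
    ultimately show ?thesis by simp
  qed
  have ED: "integral\<^sup>L N (\<lambda>\<omega>. G (\<lambda>i\<in>{..<m}. D i \<omega>)) =
      integral\<^sup>L P (\<lambda>u. G (compose {..<m} (\<lambda>u. sqrt (1 / m) * W u) u))"
    unfolding N.expectation_indep_vars[OF ne D Gm] D_law by (rule transfer) simp
  have q_lim: "filterlim q sequentially sequentially"
    unfolding q_def using m by (intro filterlim_at_top_div_const_nat)
  have c_lim: "c \<longlonglongrightarrow> sqrt (1 / m)"
  proof -
    have "(\<lambda>n. real (n div m) / real n) \<longlonglongrightarrow> 1 / m"
    proof (rule tendsto_sandwich)
      show "\<forall>\<^sub>F n in sequentially. 1 / m - 1 / real n \<le> real (n div m) / real n"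
        using eventually_gt_at_top[of 0]
      proof eventually_elim
        case (elim n)
        have "real n \<le> real (n div m) * m + m"
          using m mod_less_divisor[OF m, of n] div_mult_mod_eq[of n m]
          by (metis add_left_mono less_imp_le of_nat_add of_nat_le_iff of_nat_mult)
        from mult_left_mono[OF this, of "real n"] show ?case using elim m by (simp add: field_simps)
      qed
      show "\<forall>\<^sub>F n in sequentially. real (n div m) / real n \<le> 1 / m"
        using eventually_gt_at_top[of 0]
      proof eventually_elim
        case (elim n)
        have "real (n div m) * m \<le> real n"
          unfolding of_nat_mult[symmetric] of_nat_le_iff by simp
        then show ?case using elim m by (simp add: field_simps)
      qed
      show "(\<lambda>n. 1 / m - 1 / real n) \<longlonglongrightarrow> 1 / m"
        using tendsto_diff[OF tendsto_const lim_1_over_n, of "1 / real m"] by simp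
    qed simp
    from tendsto_real_sqrt[OF this] show ?thesis
      unfolding c_def q_def by (simp add: real_sqrt_divide)
  qed
  have "(\<lambda>n. integral\<^sup>L P (\<lambda>u. G (compose {..<m} (\<lambda>u. c n * V (q n) u) u))) \<longlonglongrightarrow>
      integral\<^sup>L P (\<lambda>u. G (compose {..<m} (\<lambda>u. sqrt (1 / m) * W u) u))"
  proof (rule integral_dominated_convergence[where w="\<lambda>_. C"])
    have "(\<lambda>u. G (compose {..<m} f u)) \<in> borel_measurable P" if [measurable]: "f \<in> borel_measurable \<Omega>" for f
    proof -
      have "compose {..<m} f \<in> measurable P (PiM {..<m} (\<lambda>_. borel))"
        unfolding compose_def P_def by (intro measurable_restrict) simp
      from measurable_compose[OF this measurable_compose[OF measurable_PiM_borel_coordinatewise Gm]]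
      show ?thesis .
    qed
    then show "(\<lambda>u. G (compose {..<m} (\<lambda>u. sqrt (1 / m) * W u) u)) \<in> borel_measurable P"
      "(\<lambda>u. G (compose {..<m} (\<lambda>u. c n * V (q n) u) u)) \<in> borel_measurable P" for n by simp_all
    show "AE u in P. (\<lambda>n. G (compose {..<m} (\<lambda>u. c n * V (q n) u) u)) \<longlonglongrightarrow>
        G (compose {..<m} (\<lambda>u. sqrt (1 / m) * W u) u)"
    proof (rule AE_I2)
      fix u assume u: "u \<in> space P"
      have "(\<lambda>n. compose {..<m} (\<lambda>u. c n * V (q n) u) u) \<longlonglongrightarrow> compose {..<m} (\<lambda>u. sqrt (1 / m) * W u) u"
      proof (rule tendsto_coordinatewise)
        fix i
        show "(\<lambda>n. compose {..<m} (\<lambda>u. c n * V (q n) u) u i) \<longlonglongrightarrow> compose {..<m} (\<lambda>u. sqrt (1 / m) * W u) u i"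
        proof (cases "i < m")
          case True
          then have "u i \<in> space \<Omega>" using u by (auto simp: P_def space_PiM)
          from tendsto_mult[OF c_lim filterlim_compose[OF lim[OF this] q_lim]] True
          show ?thesis by (simp add: compose_def)
        qed (simp add: compose_def)
      qed
      from continuous_on_tendsto_compose[OF G(1) this] show "(\<lambda>n. G (compose {..<m} (\<lambda>u. c n * V (q n) u) u)) \<longlonglongrightarrow>
        G (compose {..<m} (\<lambda>u. sqrt (1 / m) * W u) u)" by simp
    qed
  qed (auto simp: G)
  then have "(\<lambda>n. expectation (\<lambda>\<omega>. G (\<lambda>i\<in>{..<m}. \<xi> n i \<omega>))) \<longlonglongrightarrow>
      integral\<^sup>L N (\<lambda>\<omega>. G (\<lambda>i\<in>{..<m}. D i \<omega>))"
    unfolding E\<xi> ED .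
  then show ?thesis unfolding \<xi>_def q_def .
qed

end

section \<open>Convergence of the hulls\<close>

lemma graph_hull_in_K20:
  assumes "continuous_on {0..1} g" "g 0 = 0"
  shows "convex hull ((\<lambda>s::real. (s, g s)) ` {0..1}) \<in> K20"
  using assms
  by (intro convex_hull_in_K20 compact_continuous_image continuous_intros)
    (auto simp: zero_prod_def intro!: image_eqI[of _ _ 0])

text \<open>The vertices of the skeleton lie on the graph, so it remains to approximate graph points
  by vertices. Uniform continuity does this with error \<open>d / 4\<close> per coordinate, and the
  total \<open>d / 2\<close> stays strictly below \<open>d\<close>.\<close>

lemma skeleton_tendsto_graph_hull:
  assumes g: "continuous_on {0..1} g" "g 0 = 0" and f: "bcont_K20 f"
  shows "(\<lambda>m. f (skeleton m (\<lambda>i. g (real (Suc i) / real m) - g (real i / real m)))) \<longlonglongrightarrow>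
    f (convex hull ((\<lambda>s. (s, g s)) ` {0..1}))"
proof (rule LIMSEQ_I)
  fix e :: real assume "e > 0"
  let ?H = "convex hull ((\<lambda>s. (s, g s)) ` {0..1})"
  obtain d where d: "d > 0" "\<And>B. B \<in> K20 \<Longrightarrow> haus_dist ?H B < d \<Longrightarrow> \<bar>f B - f ?H\<bar> < e"
    using f graph_hull_in_K20[OF g] \<open>e > 0\<close> unfolding bcont_K20_def by meson
  have "uniformly_continuous_on {0..1} g" using g(1) compact_uniformly_continuous by blast
  then obtain d' where d': "d' > 0"
    "\<And>s t. s \<in> {0..1} \<Longrightarrow> t \<in> {0..1} \<Longrightarrow> dist t s < d' \<Longrightarrow> dist (g t) (g s) < d / 4"
    unfolding uniformly_continuous_on_def using d(1) by (metis zero_less_divide_iff zero_less_numeral)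
  obtain m0 :: nat where m0: "real m0 > max (1 / d') (4 / d)" using reals_Archimedean2 by blast
  show "\<exists>m0. \<forall>m\<ge>m0. norm (f (skeleton m (\<lambda>i. g (real (Suc i) / real m) - g (real i / real m))) - f ?H) < e"
  proof (intro exI[of _ m0] allI impI)
    fix m assume "m0 \<le> m"
    then have m: "real m > 1 / d'" "real m > 4 / d" using m0 by auto
    have "0 < 1 / d'" using d' by simp
    then have mpos: "real m > 0" using m(1) by linarith
    have m': "1 / real m < d'" "1 / real m < d / 4" using m mpos d d' by (auto simp: field_simps)
    have pts: "(\<Sum>i<j. g (real (Suc i) / real m) - g (real i / real m)) = g (real j / real m)" for j
      using sum_lessThan_telescope[of "\<lambda>i. g (real i / real m)" j] g(2) by simp
    have "haus_dist ?H (skeleton m (\<lambda>i. g (real (Suc i) / real m) - g (real i / real m))) \<le> d / 2"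
      unfolding skeleton_def pts
    proof (rule haus_dist_convex_hull_le)
      show "compact ((\<lambda>s. (s, g s)) ` {0..1})"
        using g(1) by (intro compact_continuous_image continuous_intros) auto
      fix p assume "p \<in> (\<lambda>s. (s, g s)) ` {0..1}"
      then obtain s where s: "0 \<le> s" "s \<le> 1" "p = (s, g s)" by auto
      define j where "j = nat \<lfloor>s * m\<rfloor>"
      have j: "real j \<le> s * m" "s * m < real j + 1"
        using s(1) mpos unfolding j_def by (auto simp: of_nat_nat)
      have "s * m \<le> m" using s mpos by (simp add: mult_le_cancel_right1)
      then have jm: "j \<le> m" using j(1) by (metis of_nat_le_iff order_trans)
      have "s \<le> (real j + 1) / m" "real j / m \<le> s"
        using j mpos by (auto simp: pos_le_divide_eq pos_divide_le_eq)
      then have sj: "\<bar>s - real j / m\<bar> \<le> 1 / m" by (simp add: add_divide_distrib)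
      have "dist (g s) (g (real j / m)) < d / 4"
        using s jm mpos sj m'(1) by (intro d'(2)) (auto simp: dist_real_def field_simps)
      then have "dist p (real j / m, g (real j / m)) \<le> d / 2"
        unfolding s(3) using sj m'(2) by (intro order_trans[OF dist_Pair_le]) (auto simp: dist_real_def)
      then show "\<exists>q\<in>(\<lambda>j. (real j / real m, g (real j / real m))) ` {0..m}. dist p q \<le> d / 2"
        using jm by auto
    next
      fix q assume "q \<in> (\<lambda>j. (real j / real m, g (real j / real m))) ` {0..m}"
      then obtain j where j: "j \<le> m" "q = (real j / real m, g (real j / real m))" by auto
      then have "q \<in> (\<lambda>s. (s, g s)) ` {0..1}"
        using mpos by (intro image_eqI[of _ _ "real j / m"]) auto
      then show "\<exists>p\<in>(\<lambda>s. (s, g s)) ` {0..1}. dist q p \<le> d / 2"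
        using d(1) by (intro bexI[of _ q]) auto
    qed (auto intro!: finite_imp_compact)
    then show "norm (f (skeleton m (\<lambda>i. g (real (Suc i) / real m) - g (real i / real m))) - f ?H) < e"
      using d(1) d(2)[OF skeleton_in_K20] by simp
  qed
qed

lemma brownian_skeleton_measurable:
  assumes "brownian_motion N w" "bcont_K20 f"
  shows "(\<lambda>\<omega>. f (skeleton m (\<lambda>i. w \<omega> (real (Suc i) / real m) - w \<omega> (real i / real m)))) \<in> borel_measurable N"
proof -
  have [measurable]: "(\<lambda>\<omega>. w \<omega> (real i / real m)) \<in> borel_measurable N" for i
    using assms(1) by (auto simp: brownian_motion_def)
  show ?thesis
    unfolding skeleton_def
  proof (intro borel_measurable_K20_hull assms(2))
    show "(\<lambda>\<omega>. (real j / real m, \<Sum>i<j. w \<omega> (real (Suc i) / real m) - w \<omega> (real i / real m)))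
        \<in> borel_measurable N" for j
      by measurable
  qed (simp add: zero_prod_def)
qed

text \<open>The hull involves uncountably many times, while \<open>brownian_motion\<close> gives
  measurability only at single times. Path continuity makes the functional a pointwise limit of
  skeleton functionals, each depending on finitely many times; the same limit with dominated
  convergence gives the expectations.\<close>

lemma brownian_graph_hull:
  assumes "brownian_motion N w" "bcont_K20 f"
  shows brownian_graph_hull_measurable:
      "(\<lambda>\<omega>. f (convex hull ((\<lambda>s. (s, w \<omega> s)) ` {0..1}))) \<in> borel_measurable N"
    and brownian_skeleton_expectation_tendsto:
      "(\<lambda>m. integral\<^sup>L N (\<lambda>\<omega>. f (skeleton m (\<lambda>i. w \<omega> (real (Suc i) / real m) - w \<omega> (real i / real m))))) \<longlonglongrightarrow>
        integral\<^sup>L N (\<lambda>\<omega>. f (convex hull ((\<lambda>s. (s, w \<omega> s)) ` {0..1})))"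
proof -
  interpret N: prob_space N using assms by (simp add: brownian_motion_def)
  have lim: "(\<lambda>m. f (skeleton m (\<lambda>i. w \<omega> (real (Suc i) / real m) - w \<omega> (real i / real m)))) \<longlonglongrightarrow>
      f (convex hull ((\<lambda>s. (s, w \<omega> s)) ` {0..1}))" if "\<omega> \<in> space N" for \<omega>
    using assms that
    by (intro skeleton_tendsto_graph_hull) (auto simp: brownian_motion_def intro: continuous_on_subset)
  show meas: "(\<lambda>\<omega>. f (convex hull ((\<lambda>s. (s, w \<omega> s)) ` {0..1}))) \<in> borel_measurable N"
    by (rule borel_measurable_LIMSEQ_metric[OF brownian_skeleton_measurable[OF assms] lim])
  obtain C where C: "\<And>A. A \<in> K20 \<Longrightarrow> \<bar>f A\<bar> \<le> C" using assms(2) unfolding bcont_K20_def by blast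
  show "(\<lambda>m. integral\<^sup>L N (\<lambda>\<omega>. f (skeleton m (\<lambda>i. w \<omega> (real (Suc i) / real m) - w \<omega> (real i / real m))))) \<longlonglongrightarrow>
        integral\<^sup>L N (\<lambda>\<omega>. f (convex hull ((\<lambda>s. (s, w \<omega> s)) ` {0..1})))"
    by (rule integral_dominated_convergence[where w="\<lambda>_. C"])
      (auto simp del: of_nat_Suc intro!: AE_I2 lim meas brownian_skeleton_measurable[OF assms] C skeleton_in_K20)
qed

context standard_iid
begin

text \<open>No independence between \<open>X\<close> and \<open>Y\<close> is required: they meet
  only in a union of two exceptional events. The error splits into \<open>\<epsilon> / 2\<close> for
  walk against block skeleton, \<open>\<epsilon> / 4\<close> for block skeleton against Brownian
  skeleton at fixed \<open>m\<close>, and \<open>\<epsilon> / 4\<close> for Brownian skeleton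
  against Brownian hull.\<close>

lemma walk_hull_converges:
  fixes X :: "nat \<Rightarrow> 'a \<Rightarrow> real" and w :: "'b \<Rightarrow> real \<Rightarrow> real"
  assumes X: "indep_vars (\<lambda>_. borel) X UNIV" "\<And>i. integrable M (\<lambda>\<omega>. (X i \<omega>)\<^sup>2)"
    "\<And>i. expectation (X i) = 1" "\<And>i. variance (X i) = v"
    and w: "brownian_motion N w" and f: "lip_K20 f C L"
  shows "(\<lambda>n. expectation (\<lambda>\<omega>. f (convex hull ((\<lambda>i. ((\<Sum>k<i. X k \<omega>) / n, (\<Sum>k<i. Y k \<omega>) / sqrt n)) ` {0..n}))))
    \<longlonglongrightarrow> integral\<^sup>L N (\<lambda>\<omega>. f (convex hull ((\<lambda>s. (s, w \<omega> s)) ` {0..1})))"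
proof (rule LIMSEQ_I)
  fix \<epsilon> :: real assume \<epsilon>: "\<epsilon> > 0"
  interpret N: prob_space N using w by (simp add: brownian_motion_def)
  have Xm[measurable]: "\<And>i. X i \<in> borel_measurable M" using X(1) by (auto simp: indep_vars_def2)
  have intX: "integrable M (X i)" for i by (rule square_integrable_imp_integrable[OF Xm X(2)])
  note fb = lip_K20_imp_bcont_K20[OF f]
  have L: "L \<ge> 0" and C: "\<And>A. A \<in> K20 \<Longrightarrow> \<bar>f A\<bar> \<le> C"
    and fL: "\<And>A B. A \<in> K20 \<Longrightarrow> B \<in> K20 \<Longrightarrow> \<bar>f A - f B\<bar> \<le> L * haus_dist A B"
    using f by (auto simp: lip_K20_def)
  have C0: "C \<ge> 0" using C[OF skeleton_in_K20[of 0 "\<lambda>_. 0"]] by linarith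
  define A where "A n \<omega> = convex hull ((\<lambda>i. ((\<Sum>k<i. X k \<omega>) / n, (\<Sum>k<i. Y k \<omega>) / sqrt n)) ` {0..n})" for n :: nat and \<omega>
  define B where "B m n \<omega> = skeleton m (\<lambda>i. (\<Sum>k\<in>{i * (n div m)..<i * (n div m) + n div m}. Y k \<omega>) / sqrt n)" for m n :: nat and \<omega>
  define H where "H m \<omega> = skeleton m (\<lambda>i. w \<omega> (real (Suc i) / real m) - w \<omega> (real i / real m))" for m :: nat and \<omega>
  define I where "I = integral\<^sup>L N (\<lambda>\<omega>. f (convex hull ((\<lambda>s. (s, w \<omega> s)) ` {0..1})))"
  have AK: "A n \<omega> \<in> K20" for n \<omega>
    unfolding A_def by (intro convex_hull_in_K20) (auto intro!: finite_imp_compact image_eqI[of _ _ 0] simp: zero_prod_def)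
  have BK: "B m n \<omega> \<in> K20" for m n \<omega> unfolding B_def by (rule skeleton_in_K20)
  have fA[measurable]: "(\<lambda>\<omega>. f (A n \<omega>)) \<in> borel_measurable M" for n
    unfolding A_def by (intro borel_measurable_K20_hull fb) (auto simp: zero_prod_def)
  have fB[measurable]: "(\<lambda>\<omega>. f (B m n \<omega>)) \<in> borel_measurable M" for m n
    unfolding B_def skeleton_def by (intro borel_measurable_K20_hull fb) (auto simp: zero_prod_def)
  have fdd: "(\<lambda>n. expectation (\<lambda>\<omega>. f (B m n \<omega>))) \<longlonglongrightarrow> integral\<^sup>L N (\<lambda>\<omega>. f (H m \<omega>))" if m: "m > 0" for m
  proof -
    let ?D = "\<lambda>i \<omega>. w \<omega> (real (Suc i) / real m) - w \<omega> (real i / real m)"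
    have "N.indep_vars (\<lambda>_. borel) ?D {..<m}"
      using w m unfolding brownian_motion_def
      by (elim conjE allE[of _ m] allE[of _ "\<lambda>i. real i / real m"]) (auto simp: divide_strict_right_mono)
    moreover have "distributed N lborel (?D i) (normal_density 0 (sqrt (1 / real m)))" for i
    proof -
      have "distributed N lborel (?D i) (normal_density 0 (sqrt (real (Suc i) / real m - real i / real m)))"
        using w m unfolding brownian_motion_def by (auto simp: divide_strict_right_mono)
      moreover have "real (Suc i) / real m - real i / real m = 1 / real m"
        by (simp add: diff_divide_distrib[symmetric])
      ultimately show ?thesis by simp
    qed
    moreover have "?D i \<in> borel_measurable N" for i
      using w by (intro borel_measurable_diff) (simp_all add: brownian_motion_def del: of_nat_Suc)
    moreover have "\<bar>f (skeleton m x)\<bar> \<le> C" for x using C skeleton_in_K20 by blast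
    ultimately show ?thesis
      using block_increments_converge[OF continuous_on_skeleton[OF fb, of m] _ m N.prob_space_axioms, where D = ?D]
      unfolding B_def H_def skeleton_restrict by blast
  qed
  \<comment> \<open>Chosen so that \<open>2 * C * \<delta>\<close> and \<open>L * (3 * e)\<close>
    are each at most \<open>\<epsilon> / 4\<close>; adding 1 to \<open>C\<close> and
    \<open>L\<close> covers the case where these vanish.\<close>
  define \<delta> where "\<delta> = \<epsilon> / (8 * (C + 1))"
  define e where "e = \<epsilon> / (12 * (L + 1))"
  have e: "e > 0" and \<delta>: "\<delta> > 0" using \<epsilon> L C0 by (auto simp: e_def \<delta>_def)
  \<comment> \<open>Three demands on \<open>m\<close>: the hypothesis of
    \<open>modulus_of_continuity\<close>, grid spacing at most \<open>e\<close>, and an exceptional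
    probability of at most \<open>\<delta> / 2\<close>.\<close>
  obtain m1 :: nat where m1: "real m1 > max (8 / e\<^sup>2) (max (1 / e) (256 / (e ^ 4 * (\<delta> / 2))))"
    using reals_Archimedean2 by blast
  have "\<forall>\<^sub>F m in sequentially. \<bar>integral\<^sup>L N (\<lambda>\<omega>. f (H m \<omega>)) - I\<bar> < \<epsilon> / 4"
    using LIMSEQ_D[OF brownian_skeleton_expectation_tendsto[OF w fb], of "\<epsilon> / 4"] \<epsilon>
    unfolding H_def I_def eventually_sequentially by simp
  then have "\<forall>\<^sub>F m in sequentially. \<bar>integral\<^sup>L N (\<lambda>\<omega>. f (H m \<omega>)) - I\<bar> < \<epsilon> / 4 \<and> m \<ge> m1"
    using eventually_ge_at_top[of m1] by (rule eventually_conj)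
  then obtain m where mI: "\<bar>integral\<^sup>L N (\<lambda>\<omega>. f (H m \<omega>)) - I\<bar> < \<epsilon> / 4" and "m \<ge> m1"
    by (auto simp: eventually_sequentially)
  then have m: "real m > 8 / e\<^sup>2" "real m > 1 / e" "real m > 256 / (e ^ 4 * (\<delta> / 2))" using m1 by auto
  have mpos: "m > 0" using m(2) e by (cases m) (auto simp: field_simps)
  have me: "1 / real m \<le> e" using m(2) mpos e by (simp add: field_simps)
  have m\<delta>: "256 / (e ^ 4 * real m) \<le> \<delta> / 2" using m(3) mpos e \<delta> by (simp add: field_simps)
  let ?T = "\<lambda>n. {\<omega>\<in>space M. \<exists>r\<le>n. \<bar>\<Sum>i<r. X i \<omega> - 1\<bar> > e * real n}"
  let ?W = "\<lambda>n. {\<omega>\<in>space M. \<exists>j\<le>m. \<exists>r\<le>n div m. \<bar>\<Sum>k\<in>{j * (n div m)..<j * (n div m) + r}. Y k \<omega>\<bar> > e * sqrt n}"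
  have "(\<lambda>n. prob (?T n)) \<longlonglongrightarrow> 0"
  proof (rule max_sum_negligible[OF _ _ _ _ e])
    show "indep_vars (\<lambda>_. borel) (\<lambda>i \<omega>. X i \<omega> - 1) UNIV"
      using X(1) by (rule indep_vars_compose2) simp
    show "integrable M (\<lambda>\<omega>. (X i \<omega> - 1)\<^sup>2)" for i
      using X(2) intX by (simp add: power2_diff)
    show "expectation (\<lambda>\<omega>. X i \<omega> - 1) = 0" "expectation (\<lambda>\<omega>. (X i \<omega> - 1)\<^sup>2) = v" for i
      using X(3,4)[of i] intX by (simp_all add: prob_space)
  qed
  then have T: "\<forall>\<^sub>F n in sequentially. prob (?T n) < \<delta> / 2" using \<delta> by (intro order_tendstoD) auto
  have W: "\<forall>\<^sub>F n in sequentially. prob (?W n) \<le> 256 / (e ^ 4 * real m)"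
    by (rule modulus_of_continuity[OF e mpos]) (use m(1) in simp)
  \<comment> \<open>\<open>n \<ge> n1\<close> gives \<open>m / n \<le> e\<close>, and
    \<open>n \<ge> m * m\<close> below gives \<open>m \<le> n div m\<close>, as
    \<open>haus_dist_walk_skeleton_le\<close> asks.\<close>
  obtain n1 :: nat where n1: "real n1 > real m / e" using reals_Archimedean2 by blast
  have "\<forall>\<^sub>F n in sequentially. \<bar>expectation (\<lambda>\<omega>. f (B m n \<omega>)) - integral\<^sup>L N (\<lambda>\<omega>. f (H m \<omega>))\<bar> < \<epsilon> / 4"
    using LIMSEQ_D[OF fdd[OF mpos], of "\<epsilon> / 4"] \<epsilon> unfolding eventually_sequentially by simp
  with T W eventually_ge_at_top[of "m * m"] eventually_ge_at_top[of n1] eventually_gt_at_top[of 0]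
  have "\<forall>\<^sub>F n in sequentially. norm (expectation (\<lambda>\<omega>. f (A n \<omega>)) - I) < \<epsilon>"
  proof eventually_elim
    case (elim n)
    have mn: "real m / real n \<le> e"
    proof -
      have "real m < e * real n1" using n1 e by (simp add: field_simps)
      also have "\<dots> \<le> e * real n" using elim e by simp
      finally show ?thesis using elim by (simp add: field_simps)
    qed
    have mq: "m \<le> n div m" using elim mpos by (simp add: less_eq_div_iff_mult_less_eq)
    have "\<bar>expectation (\<lambda>\<omega>. f (A n \<omega>)) - expectation (\<lambda>\<omega>. f (B m n \<omega>))\<bar> \<le> L * (3 * e) + 2 * C * prob (?T n \<union> ?W n)"
    proof (rule abs_expectation_diff_le[OF prob_space_axioms fA fB])
      show "\<bar>f (A n \<omega>)\<bar> \<le> C" "\<bar>f (B m n \<omega>)\<bar> \<le> C" for \<omega> using C AK BK by auto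
      fix \<omega> assume \<omega>: "\<omega> \<in> space M" "\<omega> \<notin> ?T n \<union> ?W n"
      have "haus_dist (A n \<omega>) (B m n \<omega>) \<le> 3 * e"
        unfolding A_def B_def
      proof (rule haus_dist_walk_skeleton_le[OF mpos me _ mn refl mq])
        show "\<bar>(\<Sum>k<i. X k \<omega>) - real i\<bar> \<le> e * real n" if "i \<le> n" for i
          using \<omega> that by (auto simp: sum_subtractf not_less)
        show "\<bar>\<Sum>k\<in>{j * (n div m)..<j * (n div m) + r}. Y k \<omega>\<bar> \<le> e * sqrt n" if "j \<le> m" "r \<le> n div m" for j r
          using \<omega> that by (auto simp: not_less)
      qed (use elim in simp)
      then have "L * haus_dist (A n \<omega>) (B m n \<omega>) \<le> L * (3 * e)" using L by (rule mult_left_mono)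
      then show "\<bar>f (A n \<omega>) - f (B m n \<omega>)\<bar> \<le> L * (3 * e)" using fL[OF AK BK, of n \<omega> m n \<omega>] by linarith
    qed (use L e in auto)
    also have "\<dots> \<le> \<epsilon> / 4 + \<epsilon> / 4"
    proof (rule add_mono)
      show "L * (3 * e) \<le> \<epsilon> / 4" using L \<epsilon> by (simp add: e_def field_simps)
      have "prob (?T n \<union> ?W n) \<le> prob (?T n) + prob (?W n)" by (rule measure_Un_le) auto
      also have "\<dots> \<le> \<delta>" using elim m\<delta> by linarith
      finally have "2 * C * prob (?T n \<union> ?W n) \<le> 2 * C * \<delta>" using C0 by (intro mult_left_mono) auto
      also have "\<dots> \<le> \<epsilon> / 4" using C0 \<epsilon> by (simp add: \<delta>_def field_simps)
      finally show "2 * C * prob (?T n \<union> ?W n) \<le> \<epsilon> / 4" .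
    qed
    finally have "\<bar>expectation (\<lambda>\<omega>. f (A n \<omega>)) - expectation (\<lambda>\<omega>. f (B m n \<omega>))\<bar> \<le> \<epsilon> / 2" by simp
    then show ?case using elim mI unfolding real_norm_def by linarith
  qed
  then show "\<exists>n0. \<forall>n\<ge>n0. norm (expectation (\<lambda>\<omega>. f (convex hull ((\<lambda>i. ((\<Sum>k<i. X k \<omega>) / n, (\<Sum>k<i. Y k \<omega>) / sqrt n)) ` {0..n})))
      - integral\<^sup>L N (\<lambda>\<omega>. f (convex hull ((\<lambda>s. (s, w \<omega> s)) ` {0..1})))) < \<epsilon>"
    unfolding A_def I_def eventually_sequentially .
qed

end

section \<open>Coordinates along and across the drift\<close>

theorem theorem2p7:
  fixes M :: "'a measure" and Z :: "nat \<Rightarrow> 'a \<Rightarrow> real \<times> real"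
    and N :: "'b measure" and w :: "'b \<Rightarrow> real \<Rightarrow> real"
  assumes "prob_space M"
    and "\<And>k. Z k \<in> borel_measurable M"
    and "prob_space.indep_vars M (\<lambda>_. borel) Z UNIV"
    and "\<And>k. distr M borel (Z k) = distr M borel (Z 0)"
    and "integrable M (\<lambda>\<omega>. (norm (Z 0 \<omega>))\<^sup>2)"
    and "brownian_motion N w"
  defines "S \<equiv> (\<lambda>n \<omega>. \<Sum>j<n. Z j \<omega>)"
    and "\<mu> \<equiv> integral\<^sup>L M (Z 0)"
  defines "\<sigma>2 \<equiv> integral\<^sup>L M (\<lambda>\<omega>. (norm (Z 0 \<omega> - \<mu>))\<^sup>2)"
    and "\<mu>h \<equiv> (1 / norm \<mu>) *\<^sub>R \<mu>"
  defines "\<sigma>2\<mu> \<equiv> integral\<^sup>L M (\<lambda>\<omega>. ((Z 0 \<omega> - \<mu>) \<bullet> \<mu>h)\<^sup>2)"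
    and "\<mu>hp \<equiv> rot90 \<mu>h"
  defines "\<sigma>2p \<equiv> \<sigma>2 - \<sigma>2\<mu>"
  defines "\<psi> \<equiv> (\<lambda>(n::nat) (x::real \<times> real).
             ((x \<bullet> \<mu>h) / (real n * norm \<mu>), (x \<bullet> \<mu>hp) / sqrt (real n * \<sigma>2p)))"
  assumes "\<mu> \<noteq> 0" and "\<sigma>2p > 0"
  shows "weak_conv_K20 M (\<lambda>n \<omega>. \<psi> n ` (convex hull ((\<lambda>k. S k \<omega>) ` {0..n})))
           N (\<lambda>\<omega>. convex hull ((\<lambda>s. (s, w \<omega> s)) ` {0..1}))"
proof -
  interpret prob_space M by fact
  interpret N: prob_space N using assms(6) by (simp add: brownian_motion_def)
  note Z[measurable] = assms(2)
  have transfer: "integrable M (\<lambda>\<omega>. F (Z k \<omega>)) = integrable M (\<lambda>\<omega>. F (Z 0 \<omega>))"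
    "expectation (\<lambda>\<omega>. F (Z k \<omega>)) = expectation (\<lambda>\<omega>. F (Z 0 \<omega>))"
    if [measurable]: "F \<in> borel_measurable borel" for F :: "real \<times> real \<Rightarrow> real" and k
    by (simp_all add: integrable_distr_eq[OF Z that, symmetric] integral_distr[OF Z that, symmetric] assms(4)[of k])
  have \<mu>h: "\<mu>h \<bullet> \<mu>h = 1" "\<mu> \<bullet> \<mu>h = norm \<mu>"
    using \<open>\<mu> \<noteq> 0\<close> unfolding \<mu>h_def
    by (simp_all add: power2_norm_eq_inner[symmetric] power2_eq_square)
  have \<mu>_perp: "\<mu> \<bullet> \<mu>hp = 0"
    unfolding \<mu>h_def \<mu>hp_def rot90_def by (simp add: inner_prod_def)
  have pythagoras: "(norm x)\<^sup>2 = (x \<bullet> \<mu>h)\<^sup>2 + (x \<bullet> \<mu>hp)\<^sup>2" for x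
  proof -
    have "(x \<bullet> \<mu>h)\<^sup>2 + (x \<bullet> \<mu>hp)\<^sup>2 = (norm x)\<^sup>2 * (\<mu>h \<bullet> \<mu>h)"
      unfolding \<mu>hp_def rot90_def power2_norm_eq_inner
      by (simp add: inner_prod_def power2_eq_square algebra_simps)
    then show ?thesis using \<mu>h by simp
  qed
  have int_Z: "integrable M (Z 0)"
    using square_integrable_imp_integrable[of "\<lambda>\<omega>. norm (Z 0 \<omega>)"] assms(5)
    by (simp add: integrable_norm_iff)
  have int_sq: "integrable M (\<lambda>\<omega>. (Z 0 \<omega> \<bullet> v)\<^sup>2)" for v
  proof (rule Bochner_Integration.integrable_bound[of M "\<lambda>\<omega>. (norm v)\<^sup>2 * (norm (Z 0 \<omega>))\<^sup>2"])
    have "(Z 0 \<omega> \<bullet> v)\<^sup>2 \<le> (norm v)\<^sup>2 * (norm (Z 0 \<omega>))\<^sup>2" for \<omega>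
      using Cauchy_Schwarz_ineq[of "Z 0 \<omega>" v] by (simp add: power2_norm_eq_inner mult.commute)
    then show "AE \<omega> in M. norm ((Z 0 \<omega> \<bullet> v)\<^sup>2) \<le> norm ((norm v)\<^sup>2 * (norm (Z 0 \<omega>))\<^sup>2)" by simp
  qed (simp_all add: assms(5))
  have int_lin: "integrable M (\<lambda>\<omega>. Z 0 \<omega> \<bullet> v)" for v using int_Z by simp
  have E_lin: "expectation (\<lambda>\<omega>. Z 0 \<omega> \<bullet> v) = \<mu> \<bullet> v" for v
    unfolding \<mu>_def using int_Z by simp
  \<comment> \<open>In the orthonormal basis \<open>\<mu>h\<close>, \<open>\<mu>hp\<close> the total
    variance splits by Pythagoras, so \<open>\<sigma>2p\<close> is the variance of the perpendicular
    component. Its mean vanishes because \<open>\<mu>\<close> is a multiple of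
    \<open>\<mu>h\<close>, which turns the variance into a second moment.\<close>
  have \<sigma>2p: "expectation (\<lambda>\<omega>. (Z 0 \<omega> \<bullet> \<mu>hp)\<^sup>2) = \<sigma>2p"
  proof -
    have "integrable M (\<lambda>\<omega>. ((Z 0 \<omega> - \<mu>) \<bullet> \<mu>h)\<^sup>2)"
      using int_sq int_lin by (simp add: inner_diff_left power2_diff)
    then show ?thesis
      unfolding \<sigma>2p_def \<sigma>2_def \<sigma>2\<mu>_def pythagoras using int_sq by (simp add: inner_diff_left \<mu>_perp)
  qed
  define X where "X k \<omega> = (Z k \<omega> \<bullet> \<mu>h) / norm \<mu>" for k \<omega>
  define Y where "Y k \<omega> = (Z k \<omega> \<bullet> \<mu>hp) / sqrt \<sigma>2p" for k \<omega>
  interpret Y: standard_iid M Y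
  proof
    show "indep_vars (\<lambda>_. borel) Y UNIV"
      unfolding Y_def using assms(3) by (rule indep_vars_compose2) simp
    show "distr M borel (Y i) = distr M borel (Y 0)" for i
    proof -
      have "distr M borel (Y k) = distr (distr M borel (Z k)) borel (\<lambda>z. (z \<bullet> \<mu>hp) / sqrt \<sigma>2p)" for k
        unfolding Y_def by (subst distr_distr) (auto simp: o_def)
      then show ?thesis using assms(4) by metis
    qed
    show "integrable M (\<lambda>\<omega>. (Y i \<omega>)\<^sup>2)" for i
      unfolding Y_def by (subst transfer(1)) (auto simp: power_divide int_sq)
    show "expectation (Y i) = 0" for i
      unfolding Y_def by (subst transfer(2)) (auto simp: E_lin \<mu>_perp)
    show "expectation (\<lambda>\<omega>. (Y i \<omega>)\<^sup>2) = 1" for i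
      unfolding Y_def using \<open>\<sigma>2p > 0\<close> by (subst transfer(2)) (auto simp: power_divide \<sigma>2p)
  qed
  have X_indep: "indep_vars (\<lambda>_. borel) X UNIV"
    unfolding X_def using assms(3) by (rule indep_vars_compose2) simp
  have X_sq: "integrable M (\<lambda>\<omega>. (X i \<omega>)\<^sup>2)" for i
    unfolding X_def by (subst transfer(1)) (auto simp: power_divide int_sq)
  have X_mean: "expectation (X i) = 1" for i
    unfolding X_def using \<open>\<mu> \<noteq> 0\<close> by (subst transfer(2)) (auto simp: E_lin \<mu>h)
  have X_var: "variance (X i) = variance (X 0)" for i
    unfolding X_mean unfolding X_def by (rule transfer(2)) simp
  have hull: "\<psi> n ` (convex hull ((\<lambda>k. S k \<omega>) ` {0..n})) =
      convex hull ((\<lambda>i. ((\<Sum>k<i. X k \<omega>) / n, (\<Sum>k<i. Y k \<omega>) / sqrt n)) ` {0..n})" for n \<omega>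
  proof -
    \<comment> \<open>Linearity holds for every \<open>n\<close>: division by zero makes
      \<open>\<psi> 0\<close> the zero map, so \<open>n = 0\<close> needs no separate case.\<close>
    have "linear (\<psi> n)"
      unfolding \<psi>_def by (rule linearI) (simp_all add: inner_add_left add_divide_distrib)
    from convex_hull_linear_image[OF this] show ?thesis
      unfolding \<psi>_def S_def X_def Y_def
      by (simp add: image_image inner_sum_left sum_divide_distrib real_sqrt_mult mult.commute)
  qed
  show ?thesis
    unfolding hull
  proof (rule weak_conv_K20I[OF prob_space_axioms N.prob_space_axioms])
    fix n \<omega>
    show "convex hull ((\<lambda>i. ((\<Sum>k<i. X k \<omega>) / real n, (\<Sum>k<i. Y k \<omega>) / sqrt n)) ` {0..n}) \<in> K20"
      by (intro convex_hull_in_K20) (auto intro!: finite_imp_compact image_eqI[of _ _ 0] simp: zero_prod_def)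
  next
    fix \<omega> assume "\<omega> \<in> space N"
    then show "convex hull ((\<lambda>s. (s, w \<omega> s)) ` {0..1}) \<in> K20"
      using assms(6) by (intro graph_hull_in_K20) (auto simp: brownian_motion_def intro: continuous_on_subset)
  next
    fix f n assume "bcont_K20 f"
    then show "(\<lambda>\<omega>. f (convex hull ((\<lambda>i. ((\<Sum>k<i. X k \<omega>) / real n, (\<Sum>k<i. Y k \<omega>) / sqrt n)) ` {0..n})))
        \<in> borel_measurable M"
      unfolding X_def Y_def by (rule borel_measurable_K20_hull) (auto simp: zero_prod_def)
  next
    fix f assume "bcont_K20 f"
    then show "(\<lambda>\<omega>. f (convex hull ((\<lambda>s. (s, w \<omega> s)) ` {0..1}))) \<in> borel_measurable N"
      by (rule brownian_graph_hull_measurable[OF assms(6)])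
  next
    fix f C L assume "lip_K20 f C L"
    then show "(\<lambda>n. expectation (\<lambda>\<omega>. f (convex hull ((\<lambda>i. ((\<Sum>k<i. X k \<omega>) / real n, (\<Sum>k<i. Y k \<omega>) / sqrt n)) ` {0..n}))))
        \<longlonglongrightarrow> integral\<^sup>L N (\<lambda>\<omega>. f (convex hull ((\<lambda>s. (s, w \<omega> s)) ` {0..1})))"
      by (rule Y.walk_hull_converges[OF X_indep X_sq X_mean X_var assms(6)])
  qed
qed

end
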